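(* The only odd deficient-perfect number with exactly four distinct prime divisors is $3^{2}\cdot 7^{2}\cdot 11^{2}\cdot 13^{2}$. That is, a positive odd integer $n$ with exactly four distinct prime divisors is deficient-perfect if and only if $n=3^{2}\cdot 7^{2}\cdot 11^{2}\cdot 13^{2}$.
   Context: For a positive integer $n$, $\sigma(n)$ denotes the sum of the positive divisors of $n$. A positive integer $n$ is called a deficient-perfect number if there is a proper divisor $d$ of $n$ (a positive divisor $d$ of $n$ with $d<n$) such that $\sigma(n)=2n-d$. *)

theory Defs
  imports "HOL-Computational_Algebra.Primes"
begin

definition sigma :: "nat \<Rightarrow> nat"
  where "sigma n = (\<Sum>d | d dvd n. d)"

(* The constraint d < n forces n > 0 (hence d > 0) and keeps the natural-number
   subtraction 2 * n - d from truncating. *)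
definition deficient_perfect :: "nat \<Rightarrow> bool"
  where "deficient_perfect n \<longleftrightarrow> (\<exists>d. d dvd n \<and> d < n \<and> sigma n = 2 * n - d)"

end

theory Submission
  imports Defs "HOL-Number_Theory.Number_Theory" "HOL-Library.Code_Binary_Nat"
begin

text \<open>
  Let \<open>n\<close> be odd and \<open>\<sigma>(n) = 2 n - d\<close> with \<open>n = k
  d\<close> and \<open>k > 1\<close>. Then \<open>\<sigma>(n)\<close> is odd, which forces every
  exponent of \<open>n\<close> to be even, and division by \<open>n\<close> gives the equation
  \<open>\<sigma>(n)/n = 2 - 1/k\<close>, with \<open>k\<close> odd. A prime \<open>p\<close>
  with exponent at least \<open>e\<close> contributes to the left-hand side a factor between
  \<open>\<sigma>(p^e)/p^e\<close> and \<open>p/(p-1)\<close>, and exactly the lower end if its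
  exponent is \<open>e\<close>. Knowing some of the primes, lower bounds for their exponents and
  a range for \<open>k\<close> therefore confines the next prime, the exponents or
  \<open>k\<close>.

  Size alone would leave far too many cases, because \<open>k\<close> may be any divisor of
  \<open>n\<close>. Two arithmetic facts cut them down. First, \<open>d\<close> divides
  \<open>\<sigma>(n)\<close> as well as \<open>n\<close>; by lifting the exponent, the part of
  \<open>\<sigma>(p^e)\<close> made of the other primes of \<open>n\<close> is at most a
  constant times \<open>e + 1\<close>. Hence \<open>d\<close> is bounded by a constant,
  depending on the primes alone, times \<open>\<Prod>(e + 1)\<close> (lemma
  \<open>d_le\<close>), which is tiny compared with \<open>n\<close>: once all four primes are
  known, \<open>k\<close> is forced to be large and \<open>\<sigma>(n)/n\<close> to be very
  close to 2. Second, if the exponent \<open>e\<close> of \<open>p\<close> is known exactly,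
  then every prime divisor of \<open>\<sigma>(p^e)\<close> divides \<open>\<sigma>(n) = (2 k -
  1) d\<close>, so it divides \<open>2 k - 1\<close> or is another prime of \<open>n\<close>
  (lemma \<open>prime_dvd_geo\<close>).

  With these facts the case distinction is finite. The only danger is that the fourth prime or
  an exponent grows without bound while \<open>\<sigma>(n)/n\<close> converges to an admissible
  value \<open>2\<close> or \<open>2 - 1/k\<close>; but a limit involving at least one factor
  \<open>p/(p-1)\<close> with \<open>p\<close> odd has an even denominator in lowest terms,
  whereas \<open>k\<close> is odd. The resulting tree of about 1600 cases is stored as a term of
  the type \<open>cert\<close>. The function \<open>check\<close> tests the arithmetic condition
  at each node, \<open>check_sound\<close> says that a tree that passes leaves only the one
  solution, and \<open>check_certificate\<close> evaluates the test by rewriting.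
\<close>

section \<open>The sum of divisors\<close>

text \<open>The value of \<open>\<sigma>(p^e)\<close> for a prime \<open>p\<close>, see
  \<open>sigma_prime_power\<close>; the later estimates only use that it is a geometric
  sum.\<close>

definition geo :: "nat \<Rightarrow> nat \<Rightarrow> nat" where
  "geo p e = (\<Sum>i\<le>e. p ^ i)"

lemma geo_mult: "p > 0 \<Longrightarrow> geo p e * (p - 1) = p ^ (e + 1) - 1"
proof (induction e)
  case (Suc e)
  have "p ^ (e + 1) \<ge> 1" using Suc.prems by simp
  moreover have "geo p (Suc e) * (p - 1) = geo p e * (p - 1) + p ^ Suc e * (p - 1)"
    by (simp add: geo_def algebra_simps)
  moreover have "p ^ Suc e * (p - 1) = p ^ (Suc e + 1) - p ^ (e + 1)"
    by (simp add: algebra_simps)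
  moreover have "p ^ (Suc e + 1) \<ge> p ^ (e + 1)"
    using Suc.prems by (intro power_increasing) auto
  ultimately show ?case using Suc by linarith
qed (simp add: geo_def)

lemma geo_pos: "geo p e > 0"
proof -
  have "p ^ 0 \<le> geo p e"
    unfolding geo_def by (rule member_le_sum) auto
  then show ?thesis by simp
qed

lemma sigma_prime_power:
  assumes "prime p"
  shows "sigma (p ^ e) = geo p e"
proof -
  have "{d. d dvd p ^ e} = (\<lambda>i. p ^ i) ` {..e}"
    using divides_primepow_nat[OF assms] by auto
  moreover have "inj_on (\<lambda>i. p ^ i) {..e}"
    using prime_gt_1_nat[OF assms] by (auto intro!: inj_onI)
  ultimately show ?thesis
    by (simp add: sigma_def geo_def sum.reindex)
qed

text \<open>For coprime \<open>a\<close> and \<open>b\<close>, a divisor of \<open>a b\<close>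
  splits uniquely into a divisor of \<open>a\<close> and one of \<open>b\<close>, recovered as
  greatest common divisors.\<close>

lemma sigma_mult_coprime:
  assumes "coprime a b" "a > 0" "b > 0"
  shows "sigma (a * b) = sigma a * sigma b"
proof -
  have gcds: "gcd (x * y) a = x \<and> gcd (x * y) b = y" if "x dvd a" "y dvd b" for x y
  proof -
    have "coprime x b" "coprime y a"
      using that assms(1) coprime_divisors[of x a b b] coprime_divisors[of y b a a]
      by (auto simp: coprime_commute)
    then show ?thesis
      using that
      by (simp add: gcd_mult_left_right_cancel gcd_mult_left_left_cancel gcd_proj1_if_dvd coprime_commute)
  qed
  have "(\<Sum>(x, y)\<in>{d. d dvd a} \<times> {d. d dvd b}. x * y) = (\<Sum>d | d dvd a * b. d)"
  proof (rule sum.reindex_bij_witness[where i = "\<lambda>d. (gcd d a, gcd d b)" and j = "\<lambda>(x, y). x * y"])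
    fix z assume "z \<in> {d. d dvd a} \<times> {d. d dvd b}"
    then obtain x y where z: "z = (x, y)" "x dvd a" "y dvd b" by auto
    have "gcd (x * y) a = x" "gcd (x * y) b = y"
      using gcds[OF z(2,3)] by auto
    then show "(gcd (case z of (x, y) \<Rightarrow> x * y) a, gcd (case z of (x, y) \<Rightarrow> x * y) b) = z"
      using z by auto
    show "(case z of (x, y) \<Rightarrow> x * y) \<in> {d. d dvd a * b}"
      using z by (auto intro: mult_dvd_mono)
    show "(case z of (x, y) \<Rightarrow> x * y) = (case z of (x, y) \<Rightarrow> x * y)" ..
  next
    fix d assume "d \<in> {d. d dvd a * b}"
    then obtain x y where "d = x * y" "x dvd a" "y dvd b"
      using division_decomp[of d a b] by auto
    then have "gcd d a * gcd d b = d"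
      using gcds by simp
    then show "(case (gcd d a, gcd d b) of (x, y) \<Rightarrow> x * y) = d" by simp
  qed auto
  then show ?thesis
    by (simp add: sigma_def sum_product sum.cartesian_product)
qed

lemma sigma_prod_prime_powers:
  assumes "finite P" "\<And>p. p \<in> P \<Longrightarrow> prime p"
  shows "sigma (\<Prod>p\<in>P. p ^ f p) = (\<Prod>p\<in>P. geo p (f p))"
  using assms
proof (induction P)
  case (insert q P)
  have "coprime (q ^ f q) (\<Prod>p\<in>P. p ^ f p)"
  proof (rule prod_coprime_right)
    fix p assume "p \<in> P"
    then have "coprime q p"
      using insert.prems insert.hyps(2) by (intro primes_coprime) auto
    then show "coprime (q ^ f q) (p ^ f p)" by simp
  qed
  moreover have "(\<Prod>p\<in>P. p ^ f p) > 0"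
    using insert.prems by (intro prod_pos) (auto simp: prime_gt_0_nat)
  ultimately show ?case
    using insert by (simp add: sigma_mult_coprime sigma_prime_power prime_gt_0_nat)
qed (simp add: sigma_def)

lemma sigma_eq_prod_geo:
  assumes "n > 0"
  shows "sigma n = (\<Prod>p\<in>prime_factors n. geo p (multiplicity p n))"
  using sigma_prod_prime_powers[of "prime_factors n" "\<lambda>p. multiplicity p n"]
    prime_factorization_nat[of n] assms by auto


section \<open>Lifting the exponent\<close>

lemma sum_lessThan_add:
  fixes f :: "nat \<Rightarrow> nat"
  shows "(\<Sum>i<a + b. f i) = (\<Sum>i<a. f i) + (\<Sum>i<b. f (a + i))"
  by (induction b) auto

lemma geometric_sum_blocks:
  fixes x :: nat
  shows "(\<Sum>i<q * l. x ^ i) = (\<Sum>i<l. x ^ i) * (\<Sum>j<q. (x ^ l) ^ j)"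
proof (induction q)
  case (Suc q)
  have "(\<Sum>i<Suc q * l. x ^ i) = (\<Sum>i<q * l. x ^ i) + (\<Sum>i<l. x ^ (q * l + i))"
    using sum_lessThan_add[of "\<lambda>i. x ^ i" "q * l" l] by (simp add: add.commute)
  also have "(\<Sum>i<l. x ^ (q * l + i)) = (\<Sum>i<l. x ^ i) * (x ^ l) ^ q"
    by (simp add: power_add sum_distrib_left sum_distrib_right mult.commute flip: power_mult)
  finally show ?case
    using Suc by (simp add: algebra_simps)
qed simp

text \<open>If \<open>x \<equiv> 1\<close> modulo the odd prime \<open>q\<close>, the
  geometric sum of length \<open>m\<close> is congruent to \<open>m\<close>, so
  \<open>q\<close> divides it only if \<open>q\<close> divides \<open>m\<close>. In that case,
  write \<open>m = q l\<close> and split off the sum of the powers of \<open>y = x^l\<close>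
  of length \<open>q\<close>: it is congruent to \<open>q\<close> modulo \<open>q^2\<close>,
  hence contributes exactly one factor \<open>q\<close>. This is the lifting-the-exponent
  lemma for \<open>(x^m - 1)/(x - 1)\<close>.\<close>

lemma multiplicity_geometric_sum:
  fixes q x m :: nat
  assumes "prime q" "odd q" "[x = 1] (mod q)" "m > 0" "x > 0"
  shows "multiplicity q (\<Sum>i<m. x ^ i) = multiplicity q m"
  using assms(3,4,5)
proof (induction m arbitrary: x rule: less_induct)
  case (less m)
  have pow: "[x ^ i = 1] (mod q)" for i
    using cong_pow[OF less.prems(1), of i] by simp
  have "[(\<Sum>i<m. x ^ i) = (\<Sum>i<m. 1)] (mod q)"
    by (intro cong_sum pow)
  then have S: "[(\<Sum>i<m. x ^ i) = m] (mod q)" by simp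
  show ?case
  proof (cases "q dvd m")
    case False
    then have "\<not> q dvd (\<Sum>i<m. x ^ i)"
      using S cong_dvd_iff by blast
    with False show ?thesis by (simp add: not_dvd_imp_multiplicity_0)
  next
    case True
    then obtain l where l: "m = q * l" by auto
    have q1: "q > 1" using assms(1) prime_gt_1_nat by blast
    have l0: "l > 0" "l < m" using l less.prems(2) q1 by auto
    define y where "y = x ^ l"
    have y1: "[y = 1] (mod q)" unfolding y_def by (rule pow)
    have y0: "y > 0" using less.prems(3) by (simp add: y_def)
    have split: "(\<Sum>i<m. x ^ i) = (\<Sum>i<l. x ^ i) * (\<Sum>j<q. y ^ j)"
      using geometric_sum_blocks[of x q l] l by (simp add: y_def)
    have "multiplicity q (\<Sum>j<q. y ^ j) = 1"
    proof (rule multiplicity_eqI)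
      show "q ^ 1 dvd (\<Sum>j<q. y ^ j)"
      proof -
        have "[(\<Sum>j<q. y ^ j) = (\<Sum>j<q. 1)] (mod q)"
          using cong_pow[OF y1] by (intro cong_sum) simp
        then show ?thesis using cong_dvd_iff by fastforce
      qed
      show "\<not> q ^ Suc 1 dvd (\<Sum>j<q. y ^ j)"
      proof -
        obtain t where t: "y = 1 + q * t"
          using cong_to_1_nat[OF y1] y0 by (metis dvd_def le_add_diff_inverse less_eq_Suc_le One_nat_def)
        \<comment> \<open>the binomial expansion of a power of 1 + q t modulo the square of q\<close>
        have bin: "[y ^ j = 1 + j * (q * t)] (mod q ^ 2)" for j
        proof (induction j)
          case (Suc j)
          have "[y ^ Suc j = (1 + q * t) * (1 + j * (q * t))] (mod q ^ 2)"
            using cong_mult[OF cong_refl[of y] Suc] t by simp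
          also have "(1 + q * t) * (1 + j * (q * t)) = 1 + Suc j * (q * t) + q ^ 2 * (j * t * t)"
            by (simp add: algebra_simps power2_eq_square)
          also have "[\<dots> = 1 + Suc j * (q * t)] (mod q ^ 2)"
            by (simp add: cong_def)
          finally show ?case .
        qed simp
        have "[(\<Sum>j<q. y ^ j) = (\<Sum>j<q. 1 + j * (q * t))] (mod q ^ 2)"
          by (intro cong_sum bin)
        also have "(\<Sum>j<q. 1 + j * (q * t)) = q + (\<Sum>j<q. j) * (q * t)"
          by (subst sum.distrib) (simp add: sum_distrib_right)
        also have "(\<Sum>j<q. j) = q * ((q - 1) div 2)"
        proof -
          obtain s where s: "q = 2 * s + 1" using assms(2) by (elim oddE)
          have "(\<Sum>j<2 * s + 1. j) = (2 * s + 1) * s" for s :: nat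
            by (induction s) (auto simp: algebra_simps)
          then show ?thesis using s by simp
        qed
        also have "q + q * ((q - 1) div 2) * (q * t) = q + q ^ 2 * ((q - 1) div 2 * t)"
          by (simp add: power2_eq_square algebra_simps)
        also have "[\<dots> = q] (mod q ^ 2)" by (simp add: cong_def)
        finally have "[(\<Sum>j<q. y ^ j) = q] (mod q ^ 2)" .
        moreover have "\<not> q ^ 2 dvd q"
          using q1 by (auto simp: power2_eq_square dest: dvd_imp_le)
        ultimately show ?thesis
          using cong_dvd_iff by (metis Suc_1)
      qed
    qed
    moreover have "multiplicity q (\<Sum>i<l. x ^ i) = multiplicity q l"
      using less.IH[OF l0(2) less.prems(1) l0(1) less.prems(3)] .
    moreover have "(\<Sum>i<l. x ^ i) > 0" "(\<Sum>j<q. y ^ j) > 0"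
      using l0 q1 less.prems(3) y0 by (auto intro!: sum_pos simp: lessThan_empty_iff)
    ultimately have "multiplicity q (\<Sum>i<m. x ^ i) = multiplicity q l + 1"
      unfolding split
      by (subst prime_elem_multiplicity_mult_distrib[OF prime_imp_prime_elem[OF assms(1)]])
        (use less.prems(3) y0 l0 q1 in auto)
    also have "\<dots> = multiplicity q m"
      unfolding l using assms(1) l0
      by (subst prime_elem_multiplicity_mult_distrib[OF prime_imp_prime_elem[OF assms(1)]])
        (auto simp: multiplicity_prime)
    finally show ?thesis .
  qed
qed

text \<open>Repeated squaring keeps the numbers small when congruences of high powers are
  evaluated.\<close>

fun powmod :: "nat \<Rightarrow> nat \<Rightarrow> nat \<Rightarrow> nat" where
  "powmod b e m =
    (if e = 0 then 1 mod m
     else if even e then powmod (b * b mod m) (e div 2) m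
     else b * powmod (b * b mod m) (e div 2) m mod m)"

declare powmod.simps [simp del]

lemma powmod_eq: "powmod b e m = b ^ e mod m"
proof (induction b e m rule: powmod.induct)
  case (1 b e m)
  have sq: "(b * b mod m) ^ (e div 2) mod m = b ^ (2 * (e div 2)) mod m"
    by (simp add: power_mod power_mult power2_eq_square)
  show ?case
  proof (cases "e = 0")
    case True
    then show ?thesis by (simp add: powmod.simps)
  next
    case e0: False
    show ?thesis
    proof (cases "even e")
      case True
      then show ?thesis
        using e0 1(1) sq by (subst powmod.simps) simp
    next
      case False
      then have "b ^ e = b * b ^ (2 * (e div 2))"
        by (metis odd_two_times_div_two_succ power_Suc Suc_eq_plus1)
      then show ?thesis
        using e0 False 1(2) sq by (subst powmod.simps) (simp add: mod_mult_right_eq)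
    qed
  qed
qed

fun odd_part :: "nat \<Rightarrow> nat" where
  "odd_part m = (if m > 0 \<and> even m then odd_part (m div 2) else m)"

declare odd_part.simps [simp del]

lemma odd_part_props:
  "m > 0 \<Longrightarrow> odd (odd_part m) \<and> odd_part m dvd m \<and> (\<forall>l. odd l \<and> l dvd m \<longrightarrow> l dvd odd_part m)"
proof (induction m rule: odd_part.induct)
  case (1 m)
  show ?case
  proof (cases "even m")
    case True
    then have IH: "odd (odd_part (m div 2)) \<and> odd_part (m div 2) dvd m div 2 \<and>
        (\<forall>l. odd l \<and> l dvd m div 2 \<longrightarrow> l dvd odd_part (m div 2))"
      using 1 by (auto elim!: evenE)
    have "l dvd m div 2" if "odd l" "l dvd m" for l
      using that True by (metis coprime_dvd_mult_right_iff coprime_right_2_iff_odd dvd_mult_div_cancel)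
    moreover have "m div 2 dvd m" using True by (metis dvd_div_mult_self dvd_triv_left)
    ultimately show ?thesis
      using IH True 1(2) dvd_trans by (subst (1 2 3) odd_part.simps) auto
  next
    case False
    then show ?thesis by (subst (1 2 3) odd_part.simps) auto
  qed
qed

lemma cong_1_iff_dvd: "x > 0 \<Longrightarrow> [x = 1] (mod m) \<longleftrightarrow> m dvd x - 1" for x m :: nat
  by (rule cong_altdef_nat) simp

text \<open>A prime \<open>q\<close> divides \<open>\<sigma>(p^e)\<close> only if
  \<open>p^(e+1) \<equiv> 1\<close> modulo \<open>q\<close>. As \<open>e + 1\<close> is odd,
  this requires \<open>p\<close> to have odd order modulo \<open>q\<close>, i.e. \<open>p^m
  \<equiv> 1\<close> for the odd part \<open>m\<close> of \<open>q - 1\<close>. The cofactor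
  is 1 if this fails or if \<open>p \<equiv> 1\<close>, and otherwise the exact power of
  \<open>q\<close> in \<open>p^m - 1\<close>, which is \<open>q\<close> except for
  Wieferich-like pairs. The last case, a power beyond the cube, only has to be a valid
  bound.\<close>

definition cofactor :: "nat \<Rightarrow> nat \<Rightarrow> nat" where
  "cofactor q p =
    (let m = odd_part (q - 1) in
     if p mod q = 1 \<or> powmod p m q \<noteq> 1 then 1
     else if powmod p m (q ^ 2) \<noteq> 1 then q
     else if powmod p m (q ^ 3) \<noteq> 1 then q ^ 2
     else if powmod p m (q ^ 4) \<noteq> 1 then q ^ 3
     else p ^ m - 1)"

lemma cofactor_pos:
  assumes "prime q" "prime p"
  shows "cofactor q p > 0"
proof -
  have "p ^ odd_part (q - 1) > 1"
    using odd_part_props[of "q - 1"] prime_gt_1_nat[OF assms(1)] prime_gt_1_nat[OF assms(2)]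
    by (intro one_less_power) (auto intro: odd_pos)
  then show ?thesis
    using prime_gt_0_nat[OF assms(1)] by (simp add: cofactor_def Let_def)
qed

text \<open>Up to the cofactor, the power of \<open>q\<close> in \<open>\<sigma>(p^e)\<close>
  divides \<open>e + 1\<close>. If \<open>p \<equiv> 1\<close> modulo \<open>q\<close>, apply
  lifting the exponent to \<open>p\<close> itself. Otherwise put \<open>x = p^m\<close> with
  \<open>m\<close> as above: \<open>\<sigma>(p^e)\<close> divides \<open>x^(e+1) - 1\<close>,
  and lifting the exponent for \<open>x \<equiv> 1\<close> splits the power of
  \<open>q\<close> in this number into those in \<open>x - 1\<close> and \<open>e +
  1\<close>.\<close>

lemma multiplicity_geo_le:
  assumes q: "prime q" "odd q" and p: "prime p" "p \<noteq> q" and e: "even e"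
  shows "multiplicity q (geo p e) \<le> multiplicity q (cofactor q p) + multiplicity q (e + 1)"
proof (cases "q dvd geo p e")
  case False
  then show ?thesis by (simp add: not_dvd_imp_multiplicity_0)
next
  case True
  have p0: "p > 0" using p(1) prime_gt_0_nat by blast
  have q1: "q > 1" using q(1) prime_gt_1_nat by blast
  have geo_less: "geo p e = (\<Sum>i<e + 1. p ^ i)"
    by (simp add: geo_def lessThan_Suc_atMost)
  define m where "m = odd_part (q - 1)"
  have m: "odd m" "m dvd q - 1" "\<And>l. odd l \<Longrightarrow> l dvd q - 1 \<Longrightarrow> l dvd m"
    using odd_part_props[of "q - 1"] q1 unfolding m_def by auto
  show ?thesis
  proof (cases "p mod q = 1")
    case True
    then have "[p = 1] (mod q)" using q1 by (simp add: cong_def)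
    then show ?thesis
      unfolding geo_less
      using multiplicity_geometric_sum[OF q, of p "e + 1"] p0 by (simp del: sum.lessThan_Suc)
  next
    case not1: False
    have geo_eq: "geo p e * (p - 1) = p ^ (e + 1) - 1" by (rule geo_mult[OF p0])
    have "q dvd p ^ (e + 1) - 1"
      using True unfolding geo_eq[symmetric] by simp
    then have pe: "[p ^ (e + 1) = 1] (mod q)"
      using p0 cong_1_iff_dvd[of "p ^ (e + 1)" q] by simp
    have "[p ^ (q - 1) = 1] (mod q)"
      using fermat_theorem[OF q(1)] primes_dvd_imp_eq[OF q(1) p(1)] p(2) by blast
    then have "ord q p dvd q - 1" "ord q p dvd e + 1"
      using pe ord_divides'[of p "q - 1" q] ord_divides'[of p "e + 1" q] by simp_all
    moreover from this(2) have "odd (ord q p)"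
      using e by (metis dvd_trans even_plus_one_iff)
    ultimately have "ord q p dvd m" using m(3) by blast
    then have pm: "[p ^ m = 1] (mod q)"
      by (simp add: ord_divides')
    define x where "x = p ^ m"
    have m0: "m > 0" using m(1) by (auto intro: odd_pos)
    have x1: "x > 1" unfolding x_def using m0 prime_gt_1_nat[OF p(1)] by (intro one_less_power)
    have "multiplicity q (geo p e) \<le> multiplicity q (x ^ (e + 1) - 1)"
    proof (rule dvd_imp_multiplicity_le)
      have "p ^ (e + 1) - 1 dvd (p ^ (e + 1)) ^ m - 1"
      proof -
        have "[(p ^ (e + 1)) ^ m = 1 ^ m] (mod (p ^ (e + 1) - 1))"
          by (rule cong_pow) (use p0 cong_1_iff_dvd[of "p ^ (e + 1)"] in simp)
        then show ?thesis using cong_to_1_nat by simp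
      qed
      then have "geo p e dvd (p ^ (e + 1)) ^ m - 1"
        using geo_eq by (metis dvd_trans dvd_triv_left)
      then show "geo p e dvd x ^ (e + 1) - 1"
        by (simp only: x_def power_mult[symmetric] mult.commute)
      have "x ^ (e + 1) > 1" using x1 by (intro one_less_power) auto
      then show "x ^ (e + 1) - 1 \<noteq> 0" by simp
    qed
    also have "x ^ (e + 1) - 1 = geo x e * (x - 1)"
      using geo_mult[of x e] x1 by simp
    also have "multiplicity q \<dots> = multiplicity q (geo x e) + multiplicity q (x - 1)"
      using x1 geo_pos[of x e]
      by (intro prime_elem_multiplicity_mult_distrib[OF prime_imp_prime_elem[OF q(1)]]) auto
    also have "multiplicity q (geo x e) = multiplicity q (e + 1)"
      using multiplicity_geometric_sum[OF q, of x "e + 1"] pm x1 p0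
      by (simp add: geo_def lessThan_Suc_atMost x_def del: sum.lessThan_Suc)
    finally have le: "multiplicity q (geo p e) \<le> multiplicity q (e + 1) + multiplicity q (x - 1)" .
    have nd: "multiplicity q (x - 1) < j" if "x mod q ^ j \<noteq> 1" "j > 0" for j
    proof (rule multiplicity_lessI)
      show "\<not> q ^ j dvd x - 1"
      proof
        assume "q ^ j dvd x - 1"
        then have "[x = 1] (mod q ^ j)" using x1 cong_1_iff_dvd[of x] by simp
        moreover have "q ^ j > 1" using q1 that(2) by (intro one_less_power)
        ultimately show False using that q1 by (simp add: cong_def)
      qed
    qed (use x1 q1 in auto)
    have "multiplicity q (x - 1) \<le> multiplicity q (cofactor q p)"
    proof -
      have "x mod q = 1" using pm q1 by (simp add: cong_def x_def)
      then have "cofactor q p = (if x mod q ^ 2 \<noteq> 1 then q else if x mod q ^ 3 \<noteq> 1 then q ^ 2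
          else if x mod q ^ 4 \<noteq> 1 then q ^ 3 else x - 1)"
        using not1 unfolding cofactor_def Let_def powmod_eq m_def[symmetric] x_def[symmetric] by simp
      then consider "cofactor q p = x - 1"
        | "cofactor q p = q ^ 1" "x mod q ^ 2 \<noteq> 1"
        | "cofactor q p = q ^ 2" "x mod q ^ 3 \<noteq> 1"
        | "cofactor q p = q ^ 3" "x mod q ^ 4 \<noteq> 1"
        by (metis power_one_right)
      then show ?thesis
        using nd[of 2] nd[of 3] nd[of 4] q(1)
        by cases (auto simp: multiplicity_same_power multiplicity_prime)
    qed
    with le show ?thesis by simp
  qed
qed

section \<open>The abundancy of prime powers\<close>

lemma odd_geo_iff: "odd p \<Longrightarrow> odd (geo p e) \<longleftrightarrow> even e"
  by (induction e) (auto simp: geo_def)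

definition abund :: "nat \<Rightarrow> nat \<Rightarrow> real" where
  "abund p e = real (geo p e) / real (p ^ e)"

lemma abund_eq:
  assumes "p \<ge> 2"
  shows "abund p e = real (p ^ (e + 1) - 1) / real (p ^ e * (p - 1))"
proof -
  have "real (geo p e) * real (p - 1) = real (p ^ (e + 1) - 1)"
    using geo_mult[of p e] assms by (metis of_nat_mult pos2 order_less_le_trans)
  moreover have "abund p e = real (geo p e) * real (p - 1) / (real (p ^ e) * real (p - 1))"
    using assms by (simp add: abund_def)
  ultimately show ?thesis by (simp only: of_nat_mult)
qed

lemma geo_Suc: "geo p (Suc e) = 1 + p * geo p e"
  unfolding geo_def by (subst sum.atMost_Suc_shift) (simp add: sum_distrib_left)

lemma abund_Suc: "p \<ge> 2 \<Longrightarrow> abund p (Suc e) = abund p e + 1 / real p ^ Suc e"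
  by (simp add: abund_def geo_Suc field_simps)

lemma abund_mono:
  assumes "p \<ge> 2" "e \<le> e'"
  shows "abund p e \<le> abund p e'"
  using assms(2)
proof (induction e' rule: dec_induct)
  case (step m)
  then show ?case using abund_Suc[OF assms(1), of m] by (smt (verit) divide_nonneg_nonneg of_nat_0_le_iff zero_le_power)
qed simp

lemma abund_ge_1: "p \<ge> 2 \<Longrightarrow> abund p e \<ge> 1"
  using abund_mono[of p 0 e] by (simp add: abund_def geo_def)

lemma abund_less:
  assumes "p \<ge> 2"
  shows "abund p e < real (p ^ (e + 1)) / real (p ^ e * (p - 1))"
proof -
  have "p ^ (e + 1) - 1 < p ^ (e + 1)" using assms by simp
  then have "real (p ^ (e + 1) - 1) < real (p ^ (e + 1))" by (simp only: of_nat_less_iff)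
  moreover have "real (p ^ e * (p - 1)) > 0" using assms by simp
  ultimately show ?thesis
    unfolding abund_eq[OF assms] by (rule divide_strict_right_mono)
qed

lemma abund_le: "p \<ge> 2 \<Longrightarrow> abund p e \<le> real p / real (p - 1)"
  using abund_less[of p e] by simp

lemma abund_gt:
  assumes "p \<ge> 2" "e \<ge> 2"
  shows "abund p e > (real p + 1) / real p"
proof -
  have "(real p + 1) / real p < abund p 2"
    using assms(1) by (simp add: abund_def geo_def numeral_2_eq_2 field_simps)
  also have "\<dots> \<le> abund p e" using assms by (rule abund_mono)
  finally show ?thesis .
qed

text \<open>The quotient \<open>(e + 1)/p^e\<close> decreases in \<open>e\<close>, so lower
  bounds for the exponents suffice to bound \<open>d/n\<close> from above.\<close>

lemma exponent_ratio_mono: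
  assumes "p \<ge> (2::nat)" "E \<le> e"
  shows "(e + 1) * p ^ E \<le> (E + 1) * p ^ e"
  using assms(2)
proof (induction e rule: dec_induct)
  case (step m)
  have "(Suc m + 1) * p ^ E \<le> (m + 1) * p ^ E * 2" by simp
  also have "\<dots> \<le> (E + 1) * p ^ m * p"
    using step.IH assms(1) by (rule mult_le_mono)
  finally show ?case by (simp add: algebra_simps)
qed simp

section \<open>Odd deficient-perfect numbers with four prime divisors\<close>

text \<open>Here \<open>k\<close> stands for \<open>n/d\<close>. The equation is stated as
  \<open>\<sigma>(n) + d = 2 n\<close> to stay clear of truncated subtraction.\<close>

locale solution =
  fixes n d k :: nat
  assumes n: "odd n" "n = k * d" and k: "k \<ge> 2"
    and card_primes: "card (prime_factors n) = 4"
    and sigma: "sigma n + d = 2 * n"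
begin

abbreviation P where "P \<equiv> prime_factors n"
abbreviation v where "v p \<equiv> multiplicity p n"

lemma n_pos: "n > 0" using n(1) by (auto intro: odd_pos)
lemma d_pos: "d > 0" using n_pos n(2) by auto

lemma odd_k: "odd k" and odd_d: "odd d"
  using n by simp_all

lemma prime_P: "p \<in> P \<Longrightarrow> prime p" by auto

lemma odd_P:
  assumes "p \<in> P"
  shows "odd p"
proof -
  have "p dvd n" using assms by auto
  then show ?thesis using n(1) dvd_trans by blast
qed

lemma P_ge: "p \<in> P \<Longrightarrow> p \<ge> 2"
  using prime_P prime_ge_2_nat by blast

lemma sigma_eq: "sigma n = (\<Prod>p\<in>P. geo p (v p))"
  using sigma_eq_prod_geo[OF n_pos] .

lemma sigma_eq': "sigma n = (2 * k - 1) * d"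
proof -
  have "sigma n = 2 * (k * d) - d" using sigma n(2) by simp
  then show ?thesis by (simp add: algebra_simps)
qed

lemma n_eq: "n = (\<Prod>p\<in>P. p ^ v p)"
  using prime_factorization_nat[OF n_pos] .

lemma v_pos: "p \<in> P \<Longrightarrow> v p > 0"
  using prime_factors_multiplicity by blast

text \<open>Since \<open>n\<close> and \<open>d\<close> are odd, \<open>\<sigma>(n)\<close> is
  odd, and \<open>\<sigma>(p^e)\<close> is a sum of \<open>e + 1\<close> odd numbers; so
  \<open>e + 1\<close> is odd.\<close>

lemma even_v:
  assumes "p \<in> P"
  shows "even (v p)"
proof -
  have "odd (sigma n)" using sigma odd_d by (metis even_add even_mult_iff even_numeral)
  then have "odd (geo p (v p))"
    unfolding sigma_eq using assms by (simp add: even_prod_iff)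
  then show ?thesis using odd_geo_iff[OF odd_P[OF assms]] by simp
qed

lemma v_ge_2:
  assumes "p \<in> P"
  shows "v p \<ge> 2"
  using v_pos[OF assms] even_v[OF assms] by (auto elim!: evenE)

lemma k_ge_3: "k \<ge> 3"
  using k odd_k by (cases "k = 2") auto

lemma abundancy: "(\<Prod>p\<in>P. abund p (v p)) = 2 - 1 / real k"
proof -
  have "(\<Prod>p\<in>P. abund p (v p)) = real (sigma n) / real n"
    unfolding abund_def prod_dividef sigma_eq by (subst (4) n_eq) simp
  also have "real (sigma n) = 2 * real n - real d"
    using sigma by linarith
  also have "(2 * real n - real d) / real n = 2 - 1 / real k"
    using n_pos d_pos k n(2) by (simp add: field_simps)
  finally show ?thesis .
qed

text \<open>Because \<open>\<sigma>(n) = (2 k - 1) d\<close>, the number \<open>d\<close>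
  divides the product of all \<open>\<sigma>(p^e)\<close>. The prime divisors \<open>q\<close>
  of \<open>d\<close> are primes of \<open>n\<close>, \<open>q\<close> does not divide
  \<open>\<sigma>(q^e)\<close>, and \<open>multiplicity_geo_le\<close> bounds the power of
  \<open>q\<close> in the other factors. Collecting all \<open>q\<close>, each \<open>e +
  1\<close> is needed only once, so \<open>d\<close> even divides the right-hand side.\<close>

lemma d_le:
  "d \<le> (\<Prod>q\<in>P. \<Prod>p\<in>P. if p = q then 1 else cofactor q p) * (\<Prod>p\<in>P. v p + 1)"
    (is "d \<le> ?C * ?T")
proof -
  have pos: "?C > 0" "?T > 0"
    using cofactor_pos prime_P by (auto intro!: prod_pos)
  have "d dvd ?C * ?T"
  proof (rule multiplicity_le_imp_dvd)
    fix q :: nat assume q: "prime q"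
    show "multiplicity q d \<le> multiplicity q (?C * ?T)"
    proof (cases "q dvd d")
      case False
      then show ?thesis by (simp add: not_dvd_imp_multiplicity_0)
    next
      case True
      then have "q dvd n" using n(2) by simp
      then have qP: "q \<in> P" using q n_pos by (simp add: prime_factors_dvd)
      have mp: "multiplicity q (prod f P) = (\<Sum>p\<in>P. multiplicity q (f p))"
        if "\<And>p. p \<in> P \<Longrightarrow> f p > 0" for f :: "nat \<Rightarrow> nat"
        using q by (intro prime_elem_multiplicity_prod_distrib) (auto dest: that)
      have "multiplicity q d \<le> multiplicity q (sigma n)"
        using sigma_eq' d_pos k by (intro dvd_imp_multiplicity_le) auto
      also have "\<dots> = (\<Sum>p\<in>P. multiplicity q (geo p (v p)))"
        unfolding sigma_eq using geo_pos by (intro mp) auto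
      also have "\<dots> \<le> (\<Sum>p\<in>P. multiplicity q (if p = q then 1 else cofactor q p) + multiplicity q (v p + 1))"
      proof (rule sum_mono)
        fix p assume p: "p \<in> P"
        show "multiplicity q (geo p (v p))
          \<le> multiplicity q (if p = q then 1 else cofactor q p) + multiplicity q (v p + 1)"
        proof (cases "p = q")
          case True
          have "\<not> q dvd geo q (v q)"
          proof
            assume "q dvd geo q (v q)"
            moreover obtain e where "v q = Suc e" using v_pos[OF qP] gr0_implies_Suc by blast
            ultimately have "q dvd 1 + q * geo q e" by (simp only: geo_Suc)
            then show False
              using q by (metis dvd_add_left_iff dvd_triv_left not_prime_unit)
          qed
          then show ?thesis using True by (simp add: not_dvd_imp_multiplicity_0)
        next
          case False
          then show ?thesis
            using multiplicity_geo_le[OF q odd_P[OF qP] prime_P[OF p] False even_v[OF p]] by simp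
        qed
      qed
      also have "\<dots> = multiplicity q (\<Prod>p\<in>P. if p = q then 1 else cofactor q p) + multiplicity q ?T"
        using cofactor_pos[OF q] prime_P by (subst (1 2) mp) (auto simp: sum.distrib)
      also have "multiplicity q (\<Prod>p\<in>P. if p = q then 1 else cofactor q p) \<le> multiplicity q ?C"
        using pos(1) qP by (intro dvd_imp_multiplicity_le dvd_prodI) auto
      also have "multiplicity q ?C + multiplicity q ?T = multiplicity q (?C * ?T)"
        using pos by (subst prime_elem_multiplicity_mult_distrib[OF prime_imp_prime_elem[OF q]]) auto
      finally show ?thesis by simp
    qed
  qed (use d_pos in auto)
  then show ?thesis using pos by (intro dvd_imp_le) auto
qed

end

section \<open>Certificates for the case distinction\<close>

text \<open>A case is described by a list \<open>A\<close> of known primes, a lower bound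
  \<open>L\<close> for all other primes of \<open>n\<close> and a range \<open>k1\<close> to
  \<open>k2\<close> for \<open>k\<close>, where \<open>k2 = 0\<close> means that
  \<open>k\<close> is not bounded above. An entry \<open>(p, e, x)\<close> of \<open>A\<close>
  says that \<open>p\<close> has exponent at least \<open>e\<close>, and exactly
  \<open>e\<close> if \<open>x\<close> holds.\<close>

type_synonym comp = "nat \<times> nat \<times> bool"

text \<open>The first five constructors close a case; the others split or refine it.
  \<^item> \<open>Abundant\<close>, \<open>Deficient\<close>: the bounds for \<open>\<sigma>(n)/n\<close> lie above or below every admissible \<open>2 - 1/k\<close>.
  \<^item> \<open>Near\<close>: all primes are known, \<open>d\<close> is so small that \<open>\<sigma>(n)/n = 2 - d/n\<close> exceeds the upper bound.
  \<^item> \<open>Index\<close>: all primes are known, \<open>d\<close> is so small that \<open>k = n/d\<close> exceeds \<open>k2\<close>.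
  \<^item> \<open>Exact\<close>: \<open>n\<close> is known, and it is the solution or \<open>2 n - \<sigma>(n)\<close> does not divide it.
  \<^item> \<open>Exp p e\<close>: the exponent of \<open>p\<close> is \<open>e\<close>, or at least \<open>e + 2\<close>.
  \<^item> \<open>Cut M\<close>: \<open>k \<le> M\<close>, or \<open>k \<ge> M + 2\<close>.
  \<^item> \<open>Force p e q\<close>: \<open>q\<close> divides \<open>\<sigma>(p^e)\<close>, so \<open>k\<close> is one of the listed values with \<open>q\<close> dividing \<open>2 k - 1\<close>, or
    \<open>q\<close> is another prime of \<open>n\<close>; if \<open>q < L\<close>, the latter is absurd and its certificate is a dummy.
  \<^item> \<open>Divide q\<close>: \<open>q\<close> divides the known number \<open>k\<close>, hence \<open>n\<close>.
  \<^item> \<open>Next p\<close>: the least unknown prime is \<open>p\<close>, or larger.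
  \<^item> \<open>Skip M\<close>: there is no prime between \<open>L\<close> and \<open>M\<close>.
  \<^item> \<open>From M\<close>: an unknown prime below \<open>M\<close> would make \<open>n\<close> too abundant.\<close>

datatype cert =
    Abundant | Deficient | Near | Index | Exact
  | Exp nat nat cert cert
  | Cut nat cert cert
  | Force nat nat nat "(nat \<times> cert) list" cert
  | Divide nat cert
  | Next nat cert cert
  | Skip nat cert
  | From nat cert

text \<open>Over the common denominator \<open>den A\<close>, the numbers \<open>lnum
  A\<close> and \<open>hnum A\<close> are the numerators of the lower and the upper bound for
  the contribution of the known primes to \<open>\<sigma>(n)/n\<close>; compare
  \<open>abund_eq\<close>. The products \<open>npart\<close> and \<open>epart\<close> of all
  \<open>p^e\<close> and \<open>e + 1\<close> enter the bound for \<open>d/n\<close>.\<close>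

fun lnum :: "comp list \<Rightarrow> nat" where
  "lnum [] = 1"
| "lnum ((p, e, x) # A) = (p ^ (e + 1) - 1) * lnum A"

fun hnum :: "comp list \<Rightarrow> nat" where
  "hnum [] = 1"
| "hnum ((p, e, x) # A) = (if x then p ^ (e + 1) - 1 else p ^ (e + 1)) * hnum A"

fun den :: "comp list \<Rightarrow> nat" where
  "den [] = 1"
| "den ((p, e, x) # A) = p ^ e * (p - 1) * den A"

fun npart :: "comp list \<Rightarrow> nat" where
  "npart [] = 1"
| "npart ((p, e, x) # A) = p ^ e * npart A"

fun epart :: "comp list \<Rightarrow> nat" where
  "epart [] = 1"
| "epart ((p, e, x) # A) = (e + 1) * epart A"

definition cofactors :: "nat list \<Rightarrow> nat" where
  "cofactors ps = prod_list (map (\<lambda>q. prod_list (map (\<lambda>p. if p = q then 1 else cofactor q p) ps)) ps)"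

definition dbound :: "comp list \<Rightarrow> nat" where
  "dbound A = cofactors (map fst A) * epart A"

text \<open>Composite numbers are recognised by a prime divisor up to 23. One without such a
  divisor merely has to be treated as a possible prime of \<open>n\<close>.\<close>

definition gap :: "comp list \<Rightarrow> nat \<Rightarrow> nat \<Rightarrow> bool" where
  "gap A L M \<longleftrightarrow> (\<forall>x\<in>set [L..<M]. x \<in> fst ` set A \<or>
     (\<exists>s\<in>set [2, 3, 5, 7, 11, 13, 17, 19, 23]. s < x \<and> s dvd x))"

text \<open>The primes that occur in the steps \<open>Force\<close> and
  \<open>Divide\<close>.\<close>

definition primes :: "nat list" where
  "primes = [3, 5, 7, 11, 13, 17, 19, 23, 29, 31, 37, 41, 43, 47, 53, 59, 61, 67, 71, 73, 79,
     83, 89, 107, 109, 113, 127, 131, 137, 139, 149, 151, 157, 163, 167, 173, 179,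
     181, 191, 193, 241, 307, 331, 461, 757, 1093, 1723, 1801, 3221, 3851, 10303, 19531]"

lemma prime_trial_division:
  fixes q r :: nat
  assumes "1 < q" "q < r * r" "\<And>d. 2 \<le> d \<Longrightarrow> d < r \<Longrightarrow> d < q \<Longrightarrow> \<not> d dvd q"
  shows "prime q"
proof (rule ccontr)
  assume "\<not> prime q"
  then obtain a where a: "a dvd q" "a \<noteq> 1" "a \<noteq> q"
    using assms(1) unfolding prime_nat_iff by blast
  then obtain b where b: "q = a * b" by (elim dvdE)
  have "a > 0" "b > 0" using b assms(1) by (auto intro!: Nat.gr0I)
  moreover from this have "b \<noteq> 1" "b \<noteq> q" using a b by auto
  moreover have "a < q" "b < q" using a b calculation dvd_imp_le[of a q] dvd_imp_le[of b q] assms(1)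
    by (auto simp: le_less)
  moreover have "a < r \<or> b < r" using assms(2) unfolding b by (meson leI mult_le_mono not_le)
  ultimately show False using assms(3)[of a] assms(3)[of b] a b by auto
qed

text \<open>Up to 900 trial division below 30 suffices, and below 140 for the few larger
  entries.\<close>

lemma list_all_primes: "list_all (\<lambda>q. 1 < q \<and> (let r = if q < 900 then 30 else 140 in
    q < r * r \<and> (\<forall>d\<in>set [2..<r]. d < q \<longrightarrow> \<not> d dvd q))) primes"
  by code_simp

lemma prime_primes: "q \<in> set primes \<Longrightarrow> prime q"
  using list_all_primes prime_trial_division unfolding list_all_iff Let_def by fastforce

text \<open>The number \<open>9018009\<close> is \<open>3^2 * 7^2 * 11^2 * 13^2\<close>. In
  the case \<open>Exact\<close>, both \<open>2 n - \<sigma>(n)\<close> and \<open>n\<close>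
  are multiplied by the product of all \<open>p - 1\<close>, which turns \<open>n\<close> into
  \<open>den A\<close> and \<open>\<sigma>(n)\<close> into \<open>lnum A\<close>.\<close>

fun check :: "cert \<Rightarrow> comp list \<Rightarrow> nat \<Rightarrow> nat \<Rightarrow> nat \<Rightarrow> bool" where
  "check Abundant A L k1 k2 \<longleftrightarrow>
     (if k2 = 0 then 2 * den A \<le> lnum A else (2 * k2 - 1) * den A < k2 * lnum A)"
| "check Deficient A L k1 k2 \<longleftrightarrow> 2 \<le> L \<and> 0 < k1 \<and>
     k1 * (hnum A * L ^ (4 - length A)) < (2 * k1 - 1) * (den A * (L - 1) ^ (4 - length A))"
| "check Near A L k1 k2 \<longleftrightarrow> length A = 4 \<and>
     hnum A * npart A + dbound A * den A < 2 * (npart A * den A)"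
| "check Index A L k1 k2 \<longleftrightarrow> length A = 4 \<and> k2 \<noteq> 0 \<and> k2 * dbound A < npart A"
| "check Exact A L k1 k2 \<longleftrightarrow> length A = 4 \<and> (\<forall>(p, e, x)\<in>set A. x) \<and>
     (npart A = 9018009 \<or> \<not> 2 * den A - lnum A dvd den A)"
| "check (Exp p e c c') A L k1 k2 \<longleftrightarrow> (p, e, False) \<in> set A \<and> even e \<and>
     check c (map (\<lambda>(q, f, x). if q = p then (q, f, True) else (q, f, x)) A) L k1 k2 \<and>
     check c' (map (\<lambda>(q, f, x). if q = p then (q, f + 2, x) else (q, f, x)) A) L k1 k2"
| "check (Cut M c c') A L k1 k2 \<longleftrightarrow> odd M \<and> check c A L k1 M \<and> check c' A L (M + 2) k2"
| "check (Force p e q ks c) A L k1 k2 \<longleftrightarrow> (p, e, True) \<in> set A \<and> q \<in> set primes \<and> q \<notin> fst ` set A \<and>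
     q dvd (p ^ (e + 1) - 1) div (p - 1) \<and> k2 \<noteq> 0 \<and>
     (\<forall>k\<in>set [k1..<k2 + 1]. odd k \<and> q dvd 2 * k - 1 \<longrightarrow> k \<in> fst ` set ks) \<and>
     list_all (\<lambda>(k, c). k \<noteq> 0 \<and> check c A L k k) ks \<and>
     (q < L \<or> check c ((q, 2, False) # A) L k1 k2)"
| "check (Divide q c) A L k1 k2 \<longleftrightarrow> k1 = k2 \<and> k2 \<noteq> 0 \<and> q \<in> set primes \<and> q \<notin> fst ` set A \<and> q dvd k1 \<and>
     (q < L \<or> check c ((q, 2, False) # A) L k1 k2)"
| "check (Next p c c') A L k1 k2 \<longleftrightarrow> p \<notin> fst ` set A \<and> gap A L p \<and>
     check c ((p, 2, False) # A) (p + 2) k1 k2 \<and> check c' A (p + 1) k1 k2"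
| "check (Skip M c) A L k1 k2 \<longleftrightarrow> gap A L M \<and> check c A M k1 k2"
| "check (From M c) A L k1 k2 \<longleftrightarrow> 2 \<le> M \<and>
     (if k2 = 0 then 2 * (den A * (M - 1)) \<le> lnum A * M
      else (2 * k2 - 1) * (den A * (M - 1)) \<le> k2 * (lnum A * M)) \<and>
     check c A M k1 k2"

section \<open>Soundness of certificates\<close>

context solution
begin

definition box :: "comp list \<Rightarrow> nat \<Rightarrow> nat \<Rightarrow> nat \<Rightarrow> bool" where
  "box A L k1 k2 \<longleftrightarrow> distinct (map fst A) \<and>
     (\<forall>(p, e, x)\<in>set A. p \<in> P \<and> e \<le> v p \<and> (x \<longrightarrow> v p = e)) \<and>
     (\<forall>q\<in>P. q \<notin> fst ` set A \<longrightarrow> L \<le> q) \<and> k1 \<le> k \<and> (k2 \<noteq> 0 \<longrightarrow> k \<le> k2)"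

lemma known_subset: "box A L k1 k2 \<Longrightarrow> fst ` set A \<subseteq> P"
  by (auto simp: box_def)

lemma known_prod:
  assumes "distinct (map fst A)"
  shows "(\<Prod>p\<in>fst ` set A. f p) = prod_list (map (\<lambda>c. f (fst c)) A)"
  using prod.distinct_set_conv_list[OF assms, of f] by (simp add: o_def)

lemma den_pos: "\<forall>(p, e, x)\<in>set A. p \<ge> 2 \<Longrightarrow> den A > 0"
  by (induction A rule: den.induct) auto

lemma lnum_pos: "\<forall>(p, e, x)\<in>set A. p \<ge> 2 \<Longrightarrow> lnum A > 0"
proof (induction A rule: lnum.induct)
  case (2 p e x A)
  then have "p ^ (e + 1) > 1" by (intro one_less_power) auto
  with 2 show ?case by simp
qed simp

lemma lower_known:
  assumes "\<forall>(p, e, x)\<in>set A. p \<ge> 2 \<and> e \<le> w p"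
  shows "real (lnum A) / real (den A) \<le> prod_list (map (\<lambda>c. abund (fst c) (w (fst c))) A)"
  using assms
proof (induction A rule: lnum.induct)
  case (2 p e x A)
  have "real (lnum ((p, e, x) # A)) / real (den ((p, e, x) # A))
      = abund p e * (real (lnum A) / real (den A))"
    using 2 abund_eq[of p e] by simp
  also have "\<dots> \<le> abund p (w p) * prod_list (map (\<lambda>c. abund (fst c) (w (fst c))) A)"
    using 2 abund_mono[of p e "w p"] abund_ge_1[of p "w p"] by (intro mult_mono) auto
  finally show ?case by simp
qed simp

lemma upper_known:
  assumes "\<forall>(p, e, x)\<in>set A. p \<ge> 2 \<and> (x \<longrightarrow> w p = e)"
  shows "prod_list (map (\<lambda>c. abund (fst c) (w (fst c))) A) \<le> real (hnum A) / real (den A)"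
  using assms
proof (induction A rule: hnum.induct)
  case (2 p e x A)
  have "abund p (w p) \<le> real (if x then p ^ (e + 1) - 1 else p ^ (e + 1)) / real (p ^ e * (p - 1))"
    using 2(2) abund_eq[of p e] abund_le[of p "w p"] by auto
  moreover have "abund p (w p) \<ge> 1" using 2(2) abund_ge_1 by auto
  moreover have "prod_list (map (\<lambda>c. abund (fst c) (w (fst c))) A) \<ge> 0"
    using 2(2) abund_ge_1 by (intro prod_list_nonneg) (force intro: order_trans[OF zero_le_one])
  ultimately have "abund p (w p) * prod_list (map (\<lambda>c. abund (fst c) (w (fst c))) A)
      \<le> real (if x then p ^ (e + 1) - 1 else p ^ (e + 1)) / real (p ^ e * (p - 1)) * (real (hnum A) / real (den A))"
    using 2 by (intro mult_mono) auto
  then show ?case by simp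
qed simp

definition U where "U A = P - fst ` set A"

lemma abundancy_split:
  assumes "box A L k1 k2"
  shows "2 - 1 / real k = prod_list (map (\<lambda>c. abund (fst c) (v (fst c))) A) * (\<Prod>q\<in>U A. abund q (v q))"
proof -
  have "(\<Prod>p\<in>P. abund p (v p)) = (\<Prod>q\<in>U A. abund q (v q)) * (\<Prod>p\<in>fst ` set A. abund p (v p))"
    unfolding U_def using known_subset[OF assms] by (intro prod.subset_diff) auto
  then show ?thesis
    using assms unfolding box_def by (subst (asm) known_prod) (auto simp: abundancy mult.commute)
qed

lemma card_U:
  assumes "box A L k1 k2"
  shows "card (U A) = 4 - length A"
proof -
  have "card (fst ` set A) = length A"
    using assms distinct_card[of "map fst A"] by (simp add: box_def)
  then show ?thesis
    using card_Diff_subset[of "fst ` set A" P] known_subset[OF assms] card_primes by (simp add: U_def)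
qed

lemma box_ge_2: "box A L k1 k2 \<Longrightarrow> \<forall>(p, e, x)\<in>set A. p \<ge> 2"
  using P_ge by (fastforce simp: box_def)

lemma lower_bound:
  assumes "box A L k1 k2"
  shows "real (lnum A) / real (den A) * (\<Prod>q\<in>U A. abund q (v q)) \<le> 2 - 1 / real k"
proof -
  have "\<forall>(p, e, x)\<in>set A. p \<ge> 2 \<and> e \<le> v p"
    using assms box_ge_2[OF assms] by (fastforce simp: box_def)
  moreover have "(\<Prod>q\<in>U A. abund q (v q)) \<ge> 0"
    using abund_ge_1 P_ge by (intro prod_nonneg) (force simp: U_def intro: order_trans[OF zero_le_one])
  ultimately show ?thesis
    unfolding abundancy_split[OF assms] by (intro mult_right_mono lower_known)
qed

lemma target_le:
  assumes "box A L k1 k2"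
  shows "k2 = 0 \<Longrightarrow> 2 - 1 / real k < 2" and "k2 \<noteq> 0 \<Longrightarrow> 2 - 1 / real k \<le> real (2 * k2 - 1) / real k2"
proof -
  show "2 - 1 / real k < 2" using k by simp
  assume "k2 \<noteq> 0"
  then have "k \<le> k2" using assms by (simp add: box_def)
  then have "1 / real k2 \<le> 1 / real k" using k by (intro divide_left_mono) auto
  moreover have "real (2 * k2 - 1) / real k2 = 2 - 1 / real k2"
    using \<open>k2 \<noteq> 0\<close> by (simp add: field_simps of_nat_diff)
  ultimately show "2 - 1 / real k \<le> real (2 * k2 - 1) / real k2" by linarith
qed

text \<open>The negated inequality is the test made by \<open>Abundant\<close>;
  \<open>From\<close> applies it to a larger lower bound \<open>a/b\<close>.\<close>

lemma not_too_abundant: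
  assumes "box A L k1 k2" and "b > 0" and "real a / real b \<le> 2 - 1 / real k"
  shows "\<not> (if k2 = 0 then 2 * b \<le> a else (2 * k2 - 1) * b < k2 * a)"
proof (cases "k2 = 0")
  case True
  have "real a / real b < 2" using target_le(1)[OF assms(1) True] assms(3) by linarith
  then have "real a < real (2 * b)" using assms(2) by (simp add: field_simps)
  then show ?thesis using True by (simp only: of_nat_less_iff) simp
next
  case False
  have "real a / real b \<le> real (2 * k2 - 1) / real k2"
    using target_le(2)[OF assms(1) False] assms(3) by linarith
  then have "real a * real k2 \<le> real (2 * k2 - 1) * real b"
    using False assms(2) by (simp only: divide_le_eq le_divide_eq) (auto simp: field_simps)
  then have "k2 * a \<le> (2 * k2 - 1) * b"
    by (simp only: of_nat_mult[symmetric] of_nat_le_iff mult.commute)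
  then show ?thesis using False by simp
qed

lemma check_Abundant:
  assumes "box A L k1 k2" "check Abundant A L k1 k2"
  shows False
proof -
  have "1 \<le> (\<Prod>q\<in>U A. abund q (v q))"
    using abund_ge_1 P_ge by (intro prod_ge_1) (auto simp: U_def)
  then have "real (lnum A) / real (den A) \<le> real (lnum A) / real (den A) * (\<Prod>q\<in>U A. abund q (v q))"
    using mult_left_mono[of 1 "\<Prod>q\<in>U A. abund q (v q)" "real (lnum A) / real (den A)"] by simp
  then have "real (lnum A) / real (den A) \<le> 2 - 1 / real k"
    using lower_bound[OF assms(1)] by linarith
  then show False
    using not_too_abundant[OF assms(1) den_pos[OF box_ge_2[OF assms(1)]]] assms(2) by simp
qed

text \<open>An unknown prime \<open>q < M\<close> contributes more than \<open>1 + 1/q \<ge>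
  M/(M - 1)\<close>, because its exponent is at least 2.\<close>

lemma check_From:
  assumes "box A L k1 k2" and M: "2 \<le> M"
    and c: "if k2 = 0 then 2 * (den A * (M - 1)) \<le> lnum A * M
      else (2 * k2 - 1) * (den A * (M - 1)) \<le> k2 * (lnum A * M)"
  shows "box A M k1 k2"
proof -
  have "M \<le> q" if q: "q \<in> P" "q \<notin> fst ` set A" for q
  proof (rule ccontr)
    assume "\<not> M \<le> q"
    then have qM: "q \<le> M - 1" by simp
    have qU: "q \<in> U A" using q by (simp add: U_def)
    have lpos: "real (lnum A) / real (den A) > 0"
      using lnum_pos den_pos box_ge_2[OF assms(1)] by simp
    have "real M / real (M - 1) \<le> (real q + 1) / real q"
      using qM M P_ge[OF q(1)] by (simp add: field_simps of_nat_diff)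
    also have "\<dots> < abund q (v q)" using abund_gt P_ge v_ge_2 q(1) by blast
    also have "\<dots> \<le> (\<Prod>q\<in>U A. abund q (v q))"
    proof -
      have "1 \<le> (\<Prod>q\<in>U A - {q}. abund q (v q))"
        using abund_ge_1 P_ge by (intro prod_ge_1) (auto simp: U_def)
      then show ?thesis
        using abund_ge_1[OF P_ge[OF q(1)], of "v q"] qU
        by (subst prod.remove[of _ q]) (auto simp: U_def mult_le_cancel_left1)
    qed
    finally have "real (lnum A) / real (den A) * (real M / real (M - 1))
        < real (lnum A) / real (den A) * (\<Prod>q\<in>U A. abund q (v q))"
      using lpos by (rule mult_strict_left_mono)
    also have "\<dots> \<le> 2 - 1 / real k" by (rule lower_bound[OF assms(1)])
    finally have lt: "real (lnum A * M) / real (den A * (M - 1)) < 2 - 1 / real k" by simp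
    have bpos: "den A * (M - 1) > 0" using den_pos[OF box_ge_2[OF assms(1)]] M by simp
    show False
    proof (cases "k2 = 0")
      case True
      then show ?thesis using not_too_abundant[OF assms(1) bpos less_imp_le[OF lt]] c by simp
    next
      case False
      have "real (lnum A * M) / real (den A * (M - 1)) < real (2 * k2 - 1) / real k2"
        using less_le_trans[OF lt target_le(2)[OF assms(1) False]] .
      then have "real (lnum A * M) * real k2 < real (2 * k2 - 1) * real (den A * (M - 1))"
        using False bpos by (simp only: divide_less_eq less_divide_eq) (auto simp: field_simps)
      then have "k2 * (lnum A * M) < (2 * k2 - 1) * (den A * (M - 1))"
        by (simp only: of_nat_mult[symmetric] of_nat_less_iff mult.commute)
      then show ?thesis using False c by simp
    qed
  qed
  then show ?thesis using assms(1) by (auto simp: box_def)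
qed

lemma upper_bound:
  assumes "box A L k1 k2"
  shows "2 - 1 / real k \<le> real (hnum A) / real (den A) * (\<Prod>q\<in>U A. abund q (v q))"
proof -
  have "\<forall>(p, e, x)\<in>set A. p \<ge> 2 \<and> (x \<longrightarrow> v p = e)"
    using assms box_ge_2[OF assms] by (fastforce simp: box_def)
  moreover have "(\<Prod>q\<in>U A. abund q (v q)) \<ge> 0"
    using abund_ge_1 P_ge by (intro prod_nonneg) (force simp: U_def intro: order_trans[OF zero_le_one])
  ultimately show ?thesis
    unfolding abundancy_split[OF assms] by (intro mult_right_mono upper_known)
qed

lemma check_Deficient:
  assumes "box A L k1 k2" "check Deficient A L k1 k2"
  shows False
proof -
  let ?r = "4 - length A"
  have L: "L \<ge> 2" and k1: "k1 > 0" using assms(2) by auto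
  have "(\<Prod>q\<in>U A. abund q (v q)) \<le> (\<Prod>q\<in>U A. real L / real (L - 1))"
  proof (rule prod_mono)
    fix q assume q: "q \<in> U A"
    then have qP: "q \<in> P" and Lq: "L \<le> q" using assms(1) by (auto simp: U_def box_def)
    have "abund q (v q) \<le> real q / real (q - 1)" using abund_le P_ge[OF qP] by blast
    also have "\<dots> \<le> real L / real (L - 1)"
      using L Lq by (simp add: field_simps of_nat_diff)
    finally show "0 \<le> abund q (v q) \<and> abund q (v q) \<le> real L / real (L - 1)"
      using abund_ge_1[OF P_ge[OF qP], of "v q"] by linarith
  qed
  also have "\<dots> = (real L / real (L - 1)) ^ ?r" using card_U[OF assms(1)] by simp
  finally have "real (hnum A) / real (den A) * (\<Prod>q\<in>U A. abund q (v q))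
      \<le> real (hnum A) / real (den A) * (real L / real (L - 1)) ^ ?r"
    by (intro mult_left_mono) auto
  also have "\<dots> = real (hnum A * L ^ ?r) / real (den A * (L - 1) ^ ?r)"
    by (simp add: power_divide)
  finally have "2 - 1 / real k \<le> real (hnum A * L ^ ?r) / real (den A * (L - 1) ^ ?r)"
    using upper_bound[OF assms(1)] by linarith
  moreover have "real (2 * k1 - 1) / real k1 \<le> 2 - 1 / real k"
  proof -
    have "k1 \<le> k" using assms(1) by (simp add: box_def)
    then have "1 / real k \<le> 1 / real k1" using k1 by (intro divide_left_mono) auto
    moreover have "real (2 * k1 - 1) / real k1 = 2 - 1 / real k1"
      using k1 by (simp add: field_simps of_nat_diff)
    ultimately show ?thesis by linarith
  qed
  ultimately have le: "real (2 * k1 - 1) / real k1 \<le> real (hnum A * L ^ ?r) / real (den A * (L - 1) ^ ?r)"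
    by linarith
  have "real (2 * k1 - 1) * real (den A * (L - 1) ^ ?r) \<le> real (hnum A * L ^ ?r) * real k1"
    using le k1 L den_pos[OF box_ge_2[OF assms(1)]]
    by (simp only: divide_le_eq le_divide_eq) (auto simp: field_simps)
  then have "(2 * k1 - 1) * (den A * (L - 1) ^ ?r) \<le> k1 * (hnum A * L ^ ?r)"
    by (simp only: of_nat_mult[symmetric] of_nat_le_iff mult.commute)
  then show False using assms(2) by simp
qed

end

lemma npart_pos: "\<forall>(p, e, x)\<in>set A. p \<ge> 2 \<Longrightarrow> npart A > 0"
  by (induction A rule: npart.induct) auto

lemma epart_npart_le:
  assumes "\<forall>(p, e, x)\<in>set A. p \<ge> 2 \<and> e \<le> w p"
  shows "prod_list (map (\<lambda>c. w (fst c) + 1) A) * npart A \<le> epart A * prod_list (map (\<lambda>c. fst c ^ w (fst c)) A)"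
  using assms
proof (induction A rule: npart.induct)
  case (2 p e x A)
  have "((w p + 1) * p ^ e) * (prod_list (map (\<lambda>c. w (fst c) + 1) A) * npart A)
      \<le> ((e + 1) * p ^ w p) * (epart A * prod_list (map (\<lambda>c. fst c ^ w (fst c)) A))"
    by (rule mult_le_mono) (use 2 exponent_ratio_mono[of p e "w p"] in auto)
  then show ?case by (simp add: algebra_simps)
qed simp

lemma npart_exact:
  "\<forall>(p, e, x)\<in>set A. w p = e \<Longrightarrow> prod_list (map (\<lambda>c. fst c ^ w (fst c)) A) = npart A"
  by (induction A rule: npart.induct) auto

lemma hnum_exact: "\<forall>(p, e, x)\<in>set A. x \<Longrightarrow> hnum A = lnum A"
  by (induction A rule: hnum.induct) auto

lemma den_eq_npart: "den A = npart A * prod_list (map (\<lambda>c. fst c - 1) A)"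
  by (induction A rule: den.induct) (auto simp: algebra_simps)

lemma geo_eq_div: "p \<ge> 2 \<Longrightarrow> geo p e = (p ^ (e + 1) - 1) div (p - 1)"
  using geo_mult[of p e] nonzero_mult_div_cancel_right[of "p - 1" "geo p e"] by simp

context solution
begin

lemma all_known:
  assumes "box A L k1 k2" "length A = 4"
  shows "fst ` set A = P" "U A = {}"
proof -
  have "card (U A) = 0" using card_U[OF assms(1)] assms(2) by simp
  then show "U A = {}" by (simp add: U_def)
  then show "fst ` set A = P" using known_subset[OF assms(1)] by (auto simp: U_def)
qed

lemma n_eq_prod_list:
  assumes "box A L k1 k2" "length A = 4"
  shows "n = prod_list (map (\<lambda>c. fst c ^ v (fst c)) A)"
  using n_eq known_prod[of A "\<lambda>p. p ^ v p"] assms all_known(1)[OF assms] by (simp add: box_def)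

text \<open>The bound \<open>d_le\<close> in terms of the exponents themselves turns into one
  in terms of the known lower bounds, at the price of replacing \<open>d\<close> by
  \<open>d/n\<close>.\<close>

lemma d_bound:
  assumes "box A L k1 k2" "length A = 4"
  shows "d * npart A \<le> dbound A * n"
proof -
  have dist: "distinct (map fst A)" using assms(1) by (simp add: box_def)
  have P: "P = set (map fst A)" using all_known(1)[OF assms] by simp
  have C: "(\<Prod>q\<in>P. \<Prod>p\<in>P. if p = q then 1 else cofactor q p) = cofactors (map fst A)"
    unfolding P cofactors_def by (simp only: prod.distinct_set_conv_list[OF dist])
  have T: "(\<Prod>p\<in>P. v p + 1) = prod_list (map (\<lambda>c. v (fst c) + 1) A)"
    using known_prod[OF dist, of "\<lambda>p. v p + 1"] all_known(1)[OF assms] by simp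
  have "\<forall>(p, e, x)\<in>set A. p \<ge> 2 \<and> e \<le> v p"
    using assms(1) box_ge_2[OF assms(1)] by (fastforce simp: box_def)
  note le = epart_npart_le[OF this]
  have "d * npart A \<le> cofactors (map fst A) * prod_list (map (\<lambda>c. v (fst c) + 1) A) * npart A"
    using d_le unfolding C T by (rule mult_le_mono1)
  also have "\<dots> \<le> cofactors (map fst A) * (epart A * n)"
    using le unfolding n_eq_prod_list[OF assms, symmetric] by (simp add: mult.assoc)
  finally show ?thesis by (simp add: dbound_def mult.assoc)
qed

lemma check_Near:
  assumes "box A L k1 k2" "check Near A L k1 k2"
  shows False
proof -
  have len: "length A = 4" using assms(2) by simp
  have N: "npart A > 0" and D: "den A > 0"
    using npart_pos den_pos box_ge_2[OF assms(1)] by blast+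
  have "real d * real (npart A) \<le> real (dbound A) * real n"
    using d_bound[OF assms(1) len] by (simp only: of_nat_mult[symmetric] of_nat_le_iff)
  then have "real d / real n \<le> real (dbound A) / real (npart A)"
    using N n_pos by (simp add: field_simps)
  moreover have "real d / real n = 1 / real k"
    using n(2) d_pos by simp
  moreover have "2 - 1 / real k \<le> real (hnum A) / real (den A)"
    using upper_bound[OF assms(1)] all_known(2)[OF assms(1) len] by simp
  ultimately have "2 \<le> real (hnum A) / real (den A) + real (dbound A) / real (npart A)"
    by linarith
  then have "2 * (real (npart A) * real (den A)) \<le> real (hnum A) * real (npart A) + real (dbound A) * real (den A)"
    using N D by (simp add: field_simps)
  also have "\<dots> = real (hnum A * npart A + dbound A * den A)" by simp
  also have "2 * (real (npart A) * real (den A)) = real (2 * (npart A * den A))" by simp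
  finally show False using assms(2) by (simp only: of_nat_le_iff) simp
qed

lemma check_Index:
  assumes "box A L k1 k2" "check Index A L k1 k2"
  shows False
proof -
  have "d * npart A \<le> d * (k * dbound A)"
    using d_bound[OF assms(1)] assms(2) n(2) by (simp add: algebra_simps)
  then have "npart A \<le> k * dbound A" using d_pos by simp
  also have "\<dots> \<le> k2 * dbound A" using assms by (simp add: box_def)
  finally show False using assms(2) by simp
qed

lemma check_Exact:
  assumes "box A L k1 k2" "check Exact A L k1 k2"
  shows "n = 9018009"
proof -
  let ?Q = "prod_list (map (\<lambda>c. fst c - 1) A)"
  have len: "length A = 4" and ex: "\<forall>(p, e, x)\<in>set A. x" using assms(2) by auto
  have D: "den A > 0" using den_pos box_ge_2[OF assms(1)] by blast
  have "\<forall>(p, e, x)\<in>set A. v p = e" using ex assms(1) by (fastforce simp: box_def)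
  then have nN: "n = npart A"
    by (rule trans[OF n_eq_prod_list[OF assms(1) len] npart_exact])
  have "2 - 1 / real k = real (lnum A) / real (den A)"
    using lower_bound[OF assms(1)] upper_bound[OF assms(1)] all_known(2)[OF assms(1) len]
      hnum_exact[OF ex] by simp
  moreover have "1 / real k = real d / real n" using n(2) d_pos by simp
  ultimately have "2 = real (lnum A) / real (den A) + real d / real n" by linarith
  also have "\<dots> = real (lnum A + d * ?Q) / real (den A)"
    using D n_pos unfolding den_eq_npart nN[symmetric] by (simp add: field_simps)
  finally have "real (2 * den A) = real (lnum A + d * ?Q)" using D by (simp add: field_simps)
  then have "2 * den A = lnum A + d * ?Q" by (simp only: of_nat_eq_iff)
  then have "2 * den A - lnum A = d * ?Q" by simp
  moreover have "d * ?Q dvd n * ?Q" using n(2) by (intro mult_dvd_mono) auto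
  ultimately have "2 * den A - lnum A dvd den A" by (simp add: den_eq_npart nN)
  then show ?thesis using assms(2) nN by auto
qed

lemma box_gap:
  assumes "box A L k1 k2" "gap A L M"
  shows "box A M k1 k2"
proof -
  have "M \<le> q" if q: "q \<in> P" "q \<notin> fst ` set A" for q
  proof (rule ccontr)
    assume "\<not> M \<le> q"
    then have "q \<in> set [L..<M]" using assms(1) q by (auto simp: box_def)
    then obtain s where s: "s \<in> set [2, 3, 5, 7, 11, 13, 17, 19, 23]" "s < q" "s dvd q"
      using assms(2) q(2) unfolding gap_def by blast
    then have "s = 1 \<or> s = q" using prime_P[OF q(1)] unfolding prime_nat_iff by blast
    then show False using s by auto
  qed
  then show ?thesis using assms(1) by (auto simp: box_def)
qed

lemma box_insert:
  assumes "box A L k1 k2" "q \<in> P" "q \<notin> fst ` set A"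
    and "\<And>r. r \<in> P \<Longrightarrow> r \<notin> fst ` set A \<Longrightarrow> r \<noteq> q \<Longrightarrow> L' \<le> r"
  shows "box ((q, 2, False) # A) L' k1 k2"
  using assms v_ge_2[OF assms(2)] by (auto simp: box_def)

lemma box_Next:
  assumes "box A L k1 k2" "p \<notin> fst ` set A" "gap A L p"
  shows "box ((p, 2, False) # A) (p + 2) k1 k2 \<or> box A (p + 1) k1 k2"
proof (cases "p \<in> P")
  case True
  have "p + 2 \<le> r" if r: "r \<in> P" "r \<notin> fst ` set A" "r \<noteq> p" for r
  proof -
    have "p \<le> r" using box_gap[OF assms(1,3)] r by (auto simp: box_def)
    moreover have "r \<noteq> p + 1" using odd_P[OF r(1)] odd_P[OF True] by auto
    ultimately show ?thesis using r(3) by simp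
  qed
  then show ?thesis using box_insert[OF assms(1) True assms(2)] by blast
next
  case False
  have "p + 1 \<le> r" if r: "r \<in> P" "r \<notin> fst ` set A" for r
  proof -
    have "p \<le> r" using box_gap[OF assms(1,3)] r by (auto simp: box_def)
    moreover have "r \<noteq> p" using r(1) False by blast
    ultimately show ?thesis by simp
  qed
  then show ?thesis using assms(1) by (auto simp: box_def)
qed

lemma box_Exp:
  assumes "box A L k1 k2" "(p, e, False) \<in> set A" "even e"
  shows "box (map (\<lambda>(q, f, x). if q = p then (q, f, True) else (q, f, x)) A) L k1 k2 \<or>
    box (map (\<lambda>(q, f, x). if q = p then (q, f + 2, x) else (q, f, x)) A) L k1 k2"
proof -
  have fst1: "map fst (map (\<lambda>(q, f, x). if q = p then (q, f, True) else (q, f, x)) A) = map fst A"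
    and fst2: "map fst (map (\<lambda>(q, f, x). if q = p then (q, f + 2, x) else (q, f, x)) A) = map fst A"
    by (induction A) auto
  have img1: "fst ` set (map (\<lambda>(q, f, x). if q = p then (q, f, True) else (q, f, x)) A) = fst ` set A"
    and img2: "fst ` set (map (\<lambda>(q, f, x). if q = p then (q, f + 2, x) else (q, f, x)) A) = fst ` set A"
    using arg_cong[OF fst1, of set] arg_cong[OF fst2, of set] by (simp_all only: set_map)
  have only: "f = e \<and> \<not> x" if "(p, f, x) \<in> set A" for f x
    using that assms(1,2) eq_key_imp_eq_value[of A p "(f, x)" "(e, False)"] by (auto simp: box_def)
  have known: "q \<in> P \<and> f \<le> v q \<and> (x \<longrightarrow> v q = f)" if "(q, f, x) \<in> set A" for q f x
    using that assms(1) by (auto simp: box_def)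
  have pP: "p \<in> P" and ev: "e \<le> v p" using assms(1,2) by (auto simp: box_def)
  show ?thesis
  proof (cases "v p = e")
    case True
    then have "box (map (\<lambda>(q, f, x). if q = p then (q, f, True) else (q, f, x)) A) L k1 k2"
    proof -
      have "q \<in> P \<and> f \<le> v q \<and> (x \<longrightarrow> v q = f)"
        if mem: "(q, f, x) \<in> set (map (\<lambda>(q, f, x). if q = p then (q, f, True) else (q, f, x)) A)" for q f x
      proof -
        obtain q' f' x' where c: "(q', f', x') \<in> set A"
          "(q, f, x) = (if q' = p then (q', f', True) else (q', f', x'))"
        proof -
          obtain c where h: "c \<in> set A" "(q, f, x) = (\<lambda>(q, f, x). if q = p then (q, f, True) else (q, f, x)) c"
            using mem unfolding set_map by (elim imageE)
          obtain a b y where "c = (a, b, y)" by (rule prod_cases3)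
          then show thesis using that[of a b y] h by simp
        qed
        show ?thesis
          using known[OF c(1)] only[of f' x'] c True by (cases "q' = p") auto
      qed
      then show ?thesis using assms(1) unfolding box_def fst1 img1 by blast
    qed
    then show ?thesis ..
  next
    case False
    moreover have "v p \<noteq> e + 1" using even_v[OF pP] assms(3) by auto
    ultimately have "e + 2 \<le> v p" using ev by simp
    then have "box (map (\<lambda>(q, f, x). if q = p then (q, f + 2, x) else (q, f, x)) A) L k1 k2"
    proof -
      have "q \<in> P \<and> f \<le> v q \<and> (x \<longrightarrow> v q = f)"
        if mem: "(q, f, x) \<in> set (map (\<lambda>(q, f, x). if q = p then (q, f + 2, x) else (q, f, x)) A)" for q f x
      proof -
        obtain q' f' x' where c: "(q', f', x') \<in> set A"
          "(q, f, x) = (if q' = p then (q', f' + 2, x') else (q', f', x'))"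
        proof -
          obtain c where h: "c \<in> set A" "(q, f, x) = (\<lambda>(q, f, x). if q = p then (q, f + 2, x) else (q, f, x)) c"
            using mem unfolding set_map by (elim imageE)
          obtain a b y where "c = (a, b, y)" by (rule prod_cases3)
          then show thesis using that[of a b y] h by simp
        qed
        show ?thesis
          using known[OF c(1)] only[of f' x'] c \<open>e + 2 \<le> v p\<close> by (cases "q' = p") auto
      qed
      then show ?thesis using assms(1) unfolding box_def fst2 img2 by blast
    qed
    then show ?thesis ..
  qed
qed

lemma prime_dvd_geo:
  assumes "p \<in> P" "prime q" "q dvd geo p (v p)"
  shows "q \<in> P \<or> q dvd 2 * k - 1"
proof -
  have "geo p (v p) dvd sigma n" unfolding sigma_eq using assms(1) by (intro dvd_prodI) auto
  then have "q dvd (2 * k - 1) * d" using assms(3) dvd_trans unfolding sigma_eq' by blast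
  then have "q dvd 2 * k - 1 \<or> q dvd d" using assms(2) prime_dvd_mult_iff by blast
  then show ?thesis using n(2) n_pos assms(2) by (auto simp: prime_factors_dvd)
qed

text \<open>Every splitting step covers all possibilities and every closing step refutes its
  case, or has found the solution.\<close>

theorem check_sound:
  assumes "check c A L k1 k2" "box A L k1 k2"
  shows "n = 9018009"
  using assms
proof (induction c arbitrary: A L k1 k2)
  case Abundant
  then show ?case using check_Abundant by blast
next
  case Deficient
  then show ?case using check_Deficient by blast
next
  case Near
  then show ?case using check_Near by blast
next
  case Index
  then show ?case using check_Index by blast
next
  case Exact
  then show ?case using check_Exact by blast
next
  case (Exp p e c c')
  then show ?case using box_Exp[of A L k1 k2 p e] by (simp only: check.simps) blast
next
  case (Cut M c c')
  show ?case
  proof (cases "k \<le> M")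
    case True
    then have "box A L k1 M" using Cut.prems(2) by (auto simp: box_def)
    then show ?thesis using Cut.prems(1) Cut.IH(1)[of A L k1 M] by simp
  next
    case False
    have "odd M" using Cut.prems(1) by simp
    then have "k \<noteq> M + 1" using odd_k by auto
    then have "M + 2 \<le> k" using False by simp
    then have "box A L (M + 2) k2" using Cut.prems(2) by (auto simp: box_def)
    then show ?thesis using Cut.prems(1) Cut.IH(2)[of A L "M + 2" k2] by simp
  qed
next
  case (Force p e q ks c)
  from Force.prems(1) have mem: "(p, e, True) \<in> set A"
    and q': "q \<in> set primes" and q: "q \<notin> fst ` set A" "q dvd (p ^ (e + 1) - 1) div (p - 1)"
    and k2: "k2 \<noteq> 0"
    and ks: "\<forall>k\<in>set [k1..<k2 + 1]. odd k \<and> q dvd 2 * k - 1 \<longrightarrow> k \<in> fst ` set ks"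
      "list_all (\<lambda>(k, c). k \<noteq> 0 \<and> check c A L k k) ks"
    and c: "q < L \<or> check c ((q, 2, False) # A) L k1 k2"
    unfolding check.simps by blast+
  have range: "k1 \<le> k" "k \<le> k2" and L: "\<And>r. r \<in> P \<Longrightarrow> r \<notin> fst ` set A \<Longrightarrow> L \<le> r"
    using Force.prems(2) k2 unfolding box_def by blast+
  have qpr: "prime q" using prime_primes[OF q'] .
  have pe: "p \<in> P" "v p = e"
    using mem Force.prems(2) unfolding box_def by fastforce+
  have "q dvd geo p (v p)" using q(2) geo_eq_div[OF P_ge[OF pe(1)]] pe(2) by simp
  from prime_dvd_geo[OF pe(1) qpr this] show ?case
  proof
    assume qP: "q \<in> P"
    have "box ((q, 2, False) # A) L k1 k2"
      using box_insert[OF Force.prems(2) qP q(1)] L by blast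
    moreover have "check c ((q, 2, False) # A) L k1 k2"
      using c L[OF qP q(1)] by simp
    ultimately show ?thesis by (rule Force.IH(2)[rotated])
  next
    assume "q dvd 2 * k - 1"
    moreover have "k \<in> set [k1..<k2 + 1]" using range by (auto simp: less_Suc_eq_le)
    ultimately have "k \<in> fst ` set ks" using ks(1) odd_k by blast
    then obtain c' where c': "(k, c') \<in> set ks" by auto
    then have "check c' A L k k" using ks(2) by (auto simp: list_all_iff)
    moreover have "box A L k k" using Force.prems(2) by (simp add: box_def)
    ultimately show ?thesis using Force.IH(1)[OF c', of c'] by simp
  qed
next
  case (Divide q c)
  from Divide.prems(1) have k12: "k1 = k2" "k2 \<noteq> 0" and q': "q \<in> set primes" and q: "q \<notin> fst ` set A" "q dvd k1"
    and c: "q < L \<or> check c ((q, 2, False) # A) L k1 k2"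
    unfolding check.simps by blast+
  have "k1 = k" and L: "\<And>r. r \<in> P \<Longrightarrow> r \<notin> fst ` set A \<Longrightarrow> L \<le> r"
    using Divide.prems(2) k12 unfolding box_def by auto
  then have "q dvd n" using q(2) n(2) by simp
  then have qP: "q \<in> P" using prime_primes[OF q'] n_pos by (simp add: prime_factors_dvd)
  have "box ((q, 2, False) # A) L k1 k2"
    using box_insert[OF Divide.prems(2) qP q(1)] L by blast
  moreover have "check c ((q, 2, False) # A) L k1 k2"
    using c L[OF qP q(1)] by simp
  ultimately show ?case by (rule Divide.IH[rotated])
next
  case (Next p c c')
  then show ?case using box_Next[of A L k1 k2 p] by (simp only: check.simps) blast
next
  case (Skip M c)
  then show ?case using box_gap[of A L k1 k2 M] by (simp only: check.simps) blast
next
  case (From M c)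
  then show ?case using check_From[of A L k1 k2 M] by (simp only: check.simps) blast
qed

lemma box_root: "box [] 3 3 0"
proof -
  have "3 \<le> q" if "q \<in> P" for q
    using P_ge[OF that] odd_P[OF that] by (cases "q = 2") auto
  then show ?thesis using k_ge_3 by (auto simp: box_def)
qed

end

section \<open>The case distinction\<close>

text \<open>The tree is cut into parts, whose names tell the value of \<open>k\<close> or the
  primes that are known at their roots. Small \<open>k\<close> comes first. For \<open>k =
  3\<close> and \<open>k = 9\<close> the value \<open>2 - 1/k\<close> is so small that the
  second prime can vary; for \<open>n\<close> prime to 5 or 17, respectively, these are the
  cases in which \<open>5 n\<close> or \<open>17 n\<close> would be an odd perfect number. For
  larger \<open>k\<close> the second prime is 5 or 7. The longest part is the one with the
  Fermat primes 3, 5 and 17, because \<open>3/2 * 5/4 * 17/16\<close> is just below 2, so that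
  the fourth prime ranges over a long interval.\<close>

definition cert_index_3 :: cert where
  "cert_index_3 =
    Next 5 Abundant (Next 7 Abundant (Next 11 (Exp 3 2 (Force 3 2 13 [] Abundant) (Exp 11 2 (Force
    11 2 7 [] Deficient) (Exp 3 4 (From 71 (Next 71 Abundant (Next 73 (Exp 73 2 (Force 73 2 1801
    [] Abundant) (Exp 11 4 (From 2584 (Skip 2587 Deficient)) (From 2626 (Next 2627 Index (Skip
    2629 Deficient))))) (Next 79 (From 693 (Skip 699 Deficient)) (Next 83 (From 485 (Next 487
    Index (Skip 489 Deficient))) (Next 89 (From 347 (Next 347 Abundant (Skip 349 Deficient)))
    (Next 97 (From 262 (Next 263 Deficient (Skip 265 Deficient))) (Next 101 (From 236 (Skip 239
    Deficient)) (Next 103 (From 226 (Next 227 Deficient (Skip 229 Deficient))) (Next 107 (From 209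
    (Skip 211 Deficient)) (Next 109 (From 201 (Skip 203 Deficient)) (Next 113 (From 189 (Skip 191
    Deficient)) (Next 127 (From 159 (Skip 161 Deficient)) (Next 131 (From 153 (Skip 155
    Deficient)) (Next 137 (From 146 (Skip 149 Deficient)) (Next 139 (From 144 (Skip 147
    Deficient)) (Skip 143 Deficient))))))))))))))))) (Exp 3 6 (Force 3 6 1093 [] (From 104 (Skip
    107 Deficient))) (Exp 11 4 (Force 11 4 3221 [] (From 102 (Next 103 Index (Skip 105
    Deficient)))) (Exp 3 8 (Force 3 8 13 [] Abundant) (Exp 3 10 (Force 3 10 23 [] Abundant) (From
    99 (Next 101 (Exp 101 2 (Force 101 2 10303 [] Deficient) (Exp 3 12 (From 9932 (Skip 9939
    Deficient)) (From 9987 (Next 9991 Index (Skip 10001 Deficient))))) (Next 103 (From 3381 (Next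
    3389 Index (Next 3391 Index (Next 3397 Index (Skip 3401 Deficient))))) (Next 107 (From 1510
    (Next 1511 Index (Skip 1515 Deficient))) (Next 109 (From 1197 (Skip 1201 Deficient)) (Next 113
    (From 860 (Skip 863 Deficient)) (Next 127 (From 466 (Next 467 Deficient (Skip 469 Deficient)))
    (Next 131 (From 419 (Next 419 Abundant (Skip 421 Deficient))) (Next 137 (From 367 (Next 367
    Abundant (Skip 369 Deficient))) (Next 139 (From 353 (Next 353 Abundant (Skip 355 Deficient)))
    (Next 149 (From 301 (Skip 303 Deficient)) (Next 151 (From 294 (Skip 297 Deficient)) (Next 157
    (From 273 (Skip 275 Deficient)) (Next 163 (From 257 (Next 257 Abundant (Skip 259 Deficient)))
    (Next 167 (From 247 (Skip 249 Deficient)) (Next 173 (From 235 (Skip 237 Deficient)) (Next 179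
    (From 225 (Skip 227 Deficient)) (Next 181 (From 222 (Next 223 Deficient (Skip 225 Deficient)))
    (Next 191 (From 208 (Skip 211 Deficient)) (Next 193 (From 206 (Skip 209 Deficient)) (Next 197
    (From 202 (Skip 205 Deficient)) (Next 199 Deficient (Skip 201
    Deficient)))))))))))))))))))))))))))))) (Next 13 (Exp 3 2 (Exp 13 2 (Force 13 2 61 [] (From 21
    (Skip 23 Deficient))) (From 16 (Next 17 (Exp 17 2 (Force 17 2 307 [] Abundant) (From 410 (Skip
    413 Deficient))) (Next 19 (From 109 (Next 109 Abundant (Skip 113 Deficient))) (Next 23 (From
    54 (Skip 57 Deficient)) (Next 29 (From 36 (Next 37 Deficient (Skip 39 Deficient))) (Next 31
    (Skip 35 Deficient) (Skip 33 Deficient)))))))) (Exp 3 4 (Force 3 4 11 [] Deficient) (Exp 3 6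
    (Force 3 6 1093 [] (From 40 (Next 41 Deficient (Skip 43 Deficient)))) (Exp 13 2 (Force 13 2 61
    [] (From 108 (Next 109 Deficient (Skip 111 Deficient)))) (Exp 3 8 (Force 3 8 757 [] (From 42
    (Next 43 Deficient (Skip 45 Deficient)))) (From 39 (Next 41 (Exp 41 2 (Force 41 2 1723 []
    Deficient) (From 1578 (Next 1579 Index (Next 1583 Index (Next 1591 Index (Next 1597 Index
    (Skip 1601 Deficient))))))) (Next 43 (From 553 (Next 557 Index (Skip 561 Deficient))) (Next 47
    (From 261 (Skip 263 Deficient)) (Next 53 (From 159 (Skip 161 Deficient)) (Next 59 (From 121
    (Skip 123 Deficient)) (Next 61 (From 114 (Skip 117 Deficient)) (Next 67 (From 97 (Next 97
    Abundant (Skip 99 Deficient))) (Next 71 (From 90 (Skip 93 Deficient)) (Next 73 (From 87 (Skip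
    89 Deficient)) (Next 79 Deficient (Skip 81 Deficient))))))))))))))))) (Next 17 (Exp 3 2 (Force
    3 2 13 [] Deficient) (Exp 3 4 (Force 3 4 11 [] Deficient) (Exp 17 2 (Force 17 2 307 [] (From
    24 (Skip 27 Deficient))) (From 22 (Next 23 (Exp 23 2 (Force 23 2 7 [] Deficient) (Exp 3 6
    (From 1347 (Skip 1351 Deficient)) (Exp 3 8 (Force 3 8 13 [] Deficient) (Exp 3 10 (Force 3 10
    3851 [] Deficient) (From 3501 (Next 3503 Index (Next 3511 Index (Next 3517 Index (Skip 3521
    Deficient))))))))) (Next 29 (From 99 (Next 101 Index (Next 103 Index (Skip 105 Deficient))))
    (Next 31 (From 80 (Next 83 Index (Skip 85 Deficient))) (Next 37 (From 56 (Skip 59 Deficient))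
    (Next 41 (From 49 (Skip 51 Deficient)) (Next 43 (From 46 (Next 47 Index (Skip 49 Deficient)))
    (Skip 47 Deficient))))))))))) (Next 19 (Exp 3 2 (Force 3 2 13 [] Deficient) (Exp 3 4 (Force 3
    4 11 [] Deficient) (Next 23 (From 133 (Next 137 Index (Next 139 Index (Skip 147 Deficient))))
    (Next 29 (From 59 (Next 59 Abundant (Next 61 Index (Skip 63 Deficient)))) (Next 31 (From 52
    (Next 53 Index (Skip 55 Deficient))) (Next 37 (From 41 (Next 41 Abundant (Skip 43 Deficient)))
    (Skip 41 Deficient))))))) (Next 23 (Next 29 (Next 31 Index (Next 37 Index (Skip 41
    Deficient))) (Next 31 (Skip 37 Deficient) (Skip 35 Deficient))) (Next 29 Deficient (Next 31
    Deficient (Skip 33 Deficient)))))))))"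

lemma check_index_3: "check cert_index_3 [(3, 2, False)] 5 3 3"
  by code_simp

definition cert_index_5 :: cert where
  "cert_index_5 =
    Exp 3 2 (Force 3 2 13 [] Abundant) Abundant"

lemma check_index_5: "check cert_index_5 [(5, 2, False), (3, 2, False)] 5 5 5"
  by code_simp

definition cert_index_7 :: cert where
  "cert_index_7 =
    Exp 3 2 (From 10 (Next 11 (Exp 11 2 (Force 11 2 19 [] Abundant) (Exp 7 2 (From 209 (Skip 211
    Deficient)) (From 521 (Next 521 Abundant (Next 523 Index (Skip 541 Deficient)))))) (Next 13
    (From 49 (Next 53 Index (Skip 59 Deficient))) (Next 17 (From 25 (Skip 29 Deficient)) (Next 19
    (From 22 (Next 23 Index (Skip 25 Deficient))) (Skip 23 Deficient)))))) (Exp 3 4 (Force 3 4 11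
    [] Abundant) (Exp 7 2 (Force 7 2 19 [] (From 113 (Next 113 Abundant (Skip 123 Deficient))))
    (From 17 (Next 17 Abundant (Next 19 (From 166 (Next 167 Index (Next 173 Index (Next 179 Index
    (Next 181 Index (Skip 189 Deficient)))))) (Next 23 (From 64 (Next 67 Index (Skip 69
    Deficient))) (Next 29 (From 40 (Next 41 Index (Skip 43 Deficient))) (Next 31 (From 37 (Next 37
    Abundant (Skip 39 Deficient))) (Skip 35 Deficient)))))))))"

lemma check_index_7: "check cert_index_7 [(7, 2, False), (3, 2, False)] 5 7 7"
  by code_simp

definition cert_index_9 :: cert where
  "cert_index_9 =
    Next 5 (Exp 3 2 (Force 3 2 13 [] Abundant) (Exp 5 2 (Force 5 2 31 [] Abundant) (Exp 3 4 (Force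
    3 4 11 [] Abundant) (Exp 5 4 (Force 5 4 11 [] Abundant) (Exp 3 6 (Force 3 6 1093 [] (From 144
    (Skip 147 Deficient))) (Exp 5 6 (Force 5 6 19531 [] (From 135 (Skip 137 Deficient))) (Exp 3 8
    (Force 3 8 13 [] Abundant) (Exp 5 8 (Force 5 8 31 [] Abundant) (Exp 3 10 (Force 3 10 23 []
    Abundant) (From 135 (Next 137 (Exp 137 2 (Force 137 2 73 [] Deficient) (Exp 3 12 (From 18277
    (Next 18281 Index (Next 18283 Index (Skip 18285 Deficient)))) (From 18465 (Next 18467 Index
    (Next 18481 Index (Next 18493 Index (Skip 18497 Deficient))))))) (Next 139 (Exp 139 2 (Force
    139 2 13 [] Deficient) (From 6230 (Next 6241 Index (Next 6247 Index (Skip 6257 Deficient)))))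
    (Next 149 (From 1546 (Skip 1549 Deficient)) (Next 151 (From 1358 (Skip 1361 Deficient)) (Next
    157 (From 1009 (Next 1009 Abundant (Skip 1011 Deficient))) (Next 163 (From 815 (Skip 817
    Deficient)) (Next 167 (From 727 (Next 727 Abundant (Skip 729 Deficient))) (Next 173 (From 631
    (Next 631 Abundant (Skip 633 Deficient))) (Next 179 (From 562 (Next 563 Deficient (Skip 565
    Deficient))) (Next 181 (From 543 (Skip 545 Deficient)) (Next 191 (From 469 (Skip 471
    Deficient)) (Next 193 (From 457 (Next 457 Abundant (Skip 459 Deficient))) (Next 197 (From 436
    (Skip 439 Deficient)) (Next 199 (From 427 (Skip 429 Deficient)) (Next 211 (From 380 (Skip 383
    Deficient)) (Next 223 (From 346 (Next 347 Index (Skip 349 Deficient))) (Next 227 (From 337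
    (Next 337 Abundant (Skip 339 Deficient))) (Next 229 (From 333 (Skip 335 Deficient)) (Next 233
    (From 325 (Skip 327 Deficient)) (Next 239 (From 314 (Skip 317 Deficient)) (Next 241 (From 310
    (Next 311 Deficient (Skip 313 Deficient))) (Next 251 (From 295 (Skip 297 Deficient)) (Next 257
    (From 287 (Skip 289 Deficient)) (Next 263 (From 280 (Next 281 Deficient (Skip 283 Deficient)))
    (Next 269 (From 273 (Skip 275 Deficient)) (Next 271 Deficient (Skip 273
    Deficient))))))))))))))))))))))))))))))))))))) (Next 7 (Exp 3 2 (Force 3 2 13 [] (From 27
    (Next 29 Index (Skip 31 Deficient)))) (Exp 3 4 (Force 3 4 11 [] Abundant) (Exp 7 2 (Force 7 2
    19 [] (From 39 (Skip 41 Deficient))) (From 13 (Next 13 Abundant (Next 17 (From 61 (Next 61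
    Abundant (Skip 65 Deficient))) (Next 19 (From 44 (Skip 47 Deficient)) (Next 23 (From 31 (Next
    31 Abundant (Skip 33 Deficient))) (Skip 27 Deficient))))))))) (Next 11 (Next 13 (Next 17 Index
    (Skip 19 Deficient)) (Skip 17 Deficient)) (Next 13 Deficient (Skip 17 Deficient))))"

lemma check_index_9: "check cert_index_9 [(3, 2, False)] 5 9 9"
  by code_simp

definition cert_3_5_11 :: cert where
  "cert_3_5_11 =
    Exp 3 2 (Cut 289 (Cut 31 Abundant (Cut 161 (Cut 97 (Force 3 2 13 [(33, Exp 11 2 (Force 11 2 7
    [] Deficient) Abundant), (59, Divide 59 Abundant), (85, Divide 17 Abundant)] Abundant) (Force
    3 2 13 [(111, Divide 37 Abundant), (137, Divide 137 Index)] Abundant)) (Cut 227 (Cut 163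
    (Divide 163 Index) (Force 3 2 13 [(189, Divide 7 Deficient), (215, Divide 43 Abundant)]
    Abundant)) (Force 3 2 13 [(241, Divide 241 Deficient), (267, Divide 89 Index)] Abundant))))
    (Exp 5 2 (From 63 (Next 67 (Exp 11 2 Near Abundant) (Next 71 (Exp 11 2 (Exp 71 2 Exact (Exp 71
    4 Exact Near)) (Exp 71 2 (Exp 11 4 Exact (Exp 11 6 Exact Near)) Near)) (Next 73 Near (Skip 77
    Deficient))))) (Exp 11 2 (From 124 (Next 127 (Exp 5 4 (Exp 127 2 Exact Near) Abundant) (Next
    131 (Exp 131 2 (Exp 5 4 Exact (Exp 5 6 Exact (Exp 5 8 Exact (Exp 5 10 Exact (Exp 5 12 Exact
    Near))))) (Exp 131 4 (Exp 5 4 Exact (Exp 5 6 Exact Near)) Near)) (Next 137 Near (Next 139 (Exp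
    139 2 (Exp 5 4 Exact (Exp 5 6 Exact Near)) Near) (Next 149 Near (Next 151 (Exp 151 2 (Exp 5 4
    Exact (Exp 5 6 Exact Near)) Near) (Next 157 (Exp 157 2 (Exp 5 4 Exact Near) Near) (Next 163
    Near (Next 167 (Exp 5 4 Deficient (Exp 5 6 Deficient Near)) (Skip 169 Deficient)))))))))))
    (Exp 5 4 (From 137 (Next 137 Abundant (Next 139 (Exp 139 2 (Exp 11 4 Exact Near) Near) (Next
    149 Near (Next 151 (Exp 151 2 (Exp 11 4 Exact Near) Near) (Next 157 Near (Next 163 Near (Next
    167 (Exp 167 2 (Exp 11 4 Exact Near) Near) (Next 173 Near (Next 179 (Exp 179 2 (Exp 11 4 Exact
    Near) Near) (Skip 181 Deficient))))))))))) (From 143 (Next 149 Near (Next 151 Near (Next 157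
    Near (Next 163 Near (Next 167 Near (Next 173 Near (Next 179 Near (Next 181 Near (Next 191 Near
    (Skip 193 Deficient))))))))))))))) Abundant"

lemma check_3_5_11: "check cert_3_5_11 [(11, 2, False), (5, 2, False), (3, 2, False)] 13 15 0"
  by code_simp

definition cert_3_5_13 :: cert where
  "cert_3_5_13 =
    Exp 5 2 (Exp 3 2 (Cut 69 (Force 5 2 31 [(47, From 50 (Skip 53 Deficient))] Abundant) (From 33
    (Next 37 Near (Next 41 Near (Next 43 Near (Skip 45 Deficient)))))) Abundant) (Exp 3 2 (Cut 35
    (Cut 21 Abundant (Cut 29 (Exp 13 2 (Force 13 2 61 [] Abundant) (Exp 5 4 (Force 5 4 11 []
    Deficient) (Cut 27 (Cut 25 (Cut 23 (Divide 23 Abundant) (From 488 (Next 491 Index (Skip 493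
    Deficient)))) (From 281 (Next 281 Abundant (Skip 283 Deficient)))) (From 206 (Skip 209
    Deficient))))) (Cut 31 (Divide 31 Abundant) (Cut 33 (Divide 11 Deficient) (Divide 7
    Deficient))))) (From 43 (Next 43 Abundant (Next 47 Near (Next 53 Near (Next 59 Near (Next 61
    Near (Next 67 Near (Next 71 Near (Next 73 Near (Next 79 Near (Next 83 Near (Next 89 Near (Next
    97 Near (Next 101 Near (Next 103 Near (Next 107 Near (Next 109 Near (Next 113 Near (Skip 117
    Deficient)))))))))))))))))))) Abundant)"

lemma check_3_5_13: "check cert_3_5_13 [(13, 2, False), (5, 2, False), (3, 2, False)] 15 15 0"
  by code_simp

definition cert_3_5_17 :: cert where
  "cert_3_5_17 =
    Exp 5 2 (Cut 169 (Cut 93 (Force 5 2 31 [(47, Divide 47 Index)] Index) (Force 5 2 31 [(109,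
    Divide 109 Index)] Index)) (Exp 3 2 (From 20 (Skip 23 Deficient)) (Exp 3 4 (From 61 (Next 61
    Abundant (Next 67 Near (Next 71 Near (Next 73 Near (Skip 77 Deficient)))))) (From 79 (Next 79
    Abundant (Next 83 (Exp 17 2 Near (Exp 3 6 Near Abundant)) (Next 89 Near (Next 97 Near (Next
    101 Near (Next 103 Near (Next 107 Near (Next 109 Near (Skip 113 Deficient))))))))))))) (Exp 3
    2 (Cut 51 (Force 3 2 13 [(33, Divide 11 Deficient)] Deficient) (From 24 (Next 29 Near (Next 31
    Near (Skip 33 Deficient))))) (Exp 17 2 (Cut 59 (Force 17 2 307 [] Abundant) (Cut 137 (Force 17
    2 307 [] Index) (Cut 487 (Cut 313 (Cut 227 (Force 17 2 307 [] Index) (Force 17 2 307 []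
    Index)) (Cut 401 (Force 17 2 307 [] Index) (Force 17 2 307 [(461, Divide 461 Deficient)]
    Index))) (Exp 3 4 (From 117 (Next 127 Near (Next 131 Near (Next 137 Near (Next 139 Near (Skip
    141 Deficient)))))) (Exp 3 6 (From 204 (Next 211 (Exp 5 4 Near Abundant) (Next 223 Near (Next
    227 Near (Next 229 Near (Next 233 Near (Next 239 Near (Next 241 Near (Next 251 Near (Next 257
    Near (Next 263 Near (Next 269 Near (Next 271 Near (Next 277 Near (Next 281 Near (Skip 283
    Deficient)))))))))))))))) (From 223 (Next 223 Abundant (Next 227 (Exp 5 4 Near Abundant) (Next
    229 (Exp 5 4 Near Abundant) (Next 233 (Exp 5 4 Near Abundant) (Next 239 (Exp 5 4 Near
    Abundant) (Next 241 (Exp 5 4 Near (Exp 3 8 Near Abundant)) (Next 251 Near (Next 257 Near (Next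
    263 Near (Next 269 Near (Next 271 Near (Next 277 Near (Next 281 Near (Next 283 Near (Next 293
    Near (Next 307 Near (Next 311 Near (Next 313 Near (Next 317 Near (Skip 325
    Deficient)))))))))))))))))))))))))) (Cut 193 (Cut 105 (Exp 3 4 (Force 3 4 11 [(17, Abundant),
    (39, Abundant), (61, Divide 61 Abundant), (83, Divide 83 Abundant), (105, Divide 7 Deficient)]
    Deficient) Abundant) (Cut 107 (Divide 107 Abundant) (Cut 109 (Divide 109 Abundant) (Cut 111
    (Divide 37 Abundant) (Cut 113 (Divide 113 Abundant) (Cut 115 (Divide 23 Abundant) (Cut 117
    (Divide 13 Deficient) (Cut 119 (Divide 7 Deficient) (Cut 121 (Divide 11 Deficient) (Cut 123
    (Divide 41 Abundant) (Cut 125 (Exp 3 4 (Force 3 4 11 [] Deficient) (Exp 5 4 (Force 5 4 11 []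
    Deficient) (Exp 5 6 (Force 5 6 19531 [] Index) (Exp 3 6 (Force 3 6 1093 [] Abundant)
    Abundant)))) (Cut 127 (Divide 127 Abundant) (Cut 161 (Exp 3 4 (Force 3 4 11 [(149, From 200
    (Next 211 Index (Skip 215 Deficient)))] Deficient) (Cut 145 (Cut 137 (Cut 129 (Divide 43
    Abundant) (Cut 131 (Divide 131 Abundant) (Cut 133 (Divide 7 Deficient) (Cut 135 (Exp 5 4
    (Force 5 4 11 [] Deficient) (Exp 3 6 (Force 3 6 1093 [] Abundant) (Exp 5 6 (Force 5 6 19531 []
    Deficient) (Exp 3 8 (Force 3 8 13 [] Deficient) (Exp 3 10 (Force 3 10 23 [] Abundant) (From
    4874 (Next 4877 Index (Next 4889 Index (Next 4891 Index (Next 4897 Index (Next 4903 Index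
    (Next 4909 Index (Skip 4919 Deficient))))))))))))) (Divide 137 Abundant))))) (Cut 139 (Divide
    139 Abundant) (Cut 141 (Divide 47 Abundant) (Cut 143 (Divide 11 Deficient) (Divide 29
    Abundant))))) (Cut 155 (Cut 147 (Divide 7 Deficient) (Cut 153 (Cut 149 (Divide 149 Abundant)
    (Cut 151 (Divide 151 Abundant) (Exp 5 4 (Force 5 4 11 [] Deficient) (Exp 3 6 (Force 3 6 1093
    [] Deficient) (Exp 3 8 (Force 3 8 13 [] Deficient) (From 1516 (Next 1517 Index (Next 1523
    Index (Next 1531 Index (Next 1537 Index (Next 1543 Index (Next 1549 Index (Next 1553 Index
    (Next 1559 Index (Skip 1563 Deficient))))))))))))))) (Divide 31 Abundant))) (Cut 157 (Divide
    157 Abundant) (Cut 159 (Divide 53 Abundant) (Divide 7 Deficient)))))) (Cut 179 (Cut 171 (Cut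
    163 (Divide 163 Abundant) (Cut 169 (Cut 165 (Divide 11 Deficient) (Cut 167 (Divide 167
    Abundant) (Divide 13 Deficient))) (Divide 19 Abundant))) (Cut 177 (Cut 173 (Divide 173
    Abundant) (Cut 175 (Divide 7 Deficient) (Divide 59 Abundant))) (Divide 179 Abundant))) (Cut
    187 (Cut 185 (Cut 181 (Divide 181 Index) (Cut 183 (Divide 61 Abundant) (Divide 37 Abundant)))
    (Divide 11 Deficient)) (Cut 189 (Divide 7 Deficient) (Cut 191 (Divide 191 Index) (Divide 193
    Index)))))))))))))))))) (Exp 3 4 (From 120 (Next 127 Near (Next 131 Near (Next 137 Near (Next
    139 Near (Next 149 Near (Next 151 Near (Next 157 Near (Next 163 Near (Next 167 Near (Next 173
    Near (Next 179 Near (Next 181 Near (Skip 185 Deficient)))))))))))))) (Cut 513 (From 269 (Next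
    269 Abundant (Next 271 Index (Next 277 Index (Next 281 Index (Next 283 Index (Next 293 Index
    (Next 307 Index (Next 311 Index (Next 313 Index (Next 317 Index (Next 331 Index (Next 337
    Index (Next 347 Index (Next 349 Index (Next 353 Index (Next 359 Index (Next 367 Index (Next
    373 Index (Next 379 Index (Next 383 Index (Next 389 Index (Next 397 Index (Next 401 Index
    (Next 409 Index (Next 419 Index (Next 421 Index (Next 431 Index (Next 433 Index (Next 439
    Index (Next 443 Index (Next 449 Index (Next 457 Index (Next 461 Index (Next 463 Index (Next
    467 Index (Next 479 Index (Next 487 Index (Next 491 Index (Next 499 Index (Next 503 Index
    (Next 509 Index (Next 521 Index (Next 523 Index (Next 541 Index (Next 547 Index (Next 557
    Index (Next 563 Index (Next 569 Index (Next 571 Index (Next 577 Index (Next 587 Index (Next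
    593 Index (Next 599 Index (Next 601 Index (Next 607 Index (Next 613 Index (Next 617 Index
    (Next 619 Index (Next 631 Index (Next 641 Index (Next 643 Index (Next 647 Index (Next 653
    Index (Next 659 Index (Next 661 Index (Next 673 Index (Next 677 Index (Next 683 Index (Next
    691 Index (Next 701 Index (Next 709 Index (Next 719 Index (Next 727 Index (Next 733 Index
    (Next 739 Index (Next 743 Index (Skip 745
    Deficient)))))))))))))))))))))))))))))))))))))))))))))))))))))))))))))))))))))))))))))) (Exp 5
    4 (From 213 (Next 223 (Exp 3 6 Near Abundant) (Next 227 (Exp 3 6 Near Abundant) (Next 229 (Exp
    3 6 Near Abundant) (Next 233 (Exp 3 6 Near Abundant) (Next 239 Near (Next 241 Near (Next 251
    Near (Next 257 Near (Next 263 Near (Next 269 Near (Next 271 Near (Next 277 Near (Next 281 Near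
    (Next 283 Near (Next 293 Near (Next 307 Near (Skip 309 Deficient)))))))))))))))))) (From 228
    (Next 229 (Exp 3 6 (Exp 5 6 Near Abundant) Abundant) (Next 233 (Exp 3 6 Near Abundant) (Next
    239 (Exp 3 6 Near Abundant) (Next 241 (Exp 3 6 Near Abundant) (Next 251 (Exp 3 6 Near
    Abundant) (Next 257 Near (Next 263 Near (Next 269 Near (Next 271 Near (Next 277 Near (Next 281
    Near (Next 283 Near (Next 293 Near (Next 307 Near (Next 311 Near (Next 313 Near (Next 317 Near
    (Next 331 Near (Next 337 Near (Skip 341 Deficient)))))))))))))))))))))))))))"

lemma check_3_5_17: "check cert_3_5_17 [(17, 2, False), (5, 2, False), (3, 2, False)] 19 15 0"
  by code_simp

definition cert_3_5_19 :: cert where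
  "cert_3_5_19 =
    Exp 5 2 (Cut 111 (Force 5 2 31 [(47, Divide 47 Index), (109, Divide 109 Deficient)] (Exp 3 2
    Near Abundant)) (Exp 3 2 Deficient (Exp 3 4 (From 44 (Next 47 Near (Next 53 Near (Skip 57
    Deficient)))) (From 52 (Next 53 (Exp 19 2 (Exp 3 6 Near Abundant) Abundant) (Next 59 (Exp 19 2
    (Exp 59 2 (Exp 3 6 Exact (Exp 3 8 Exact Near)) Near) Near) (Next 61 Near (Next 67 Near (Next
    71 (Exp 19 2 Deficient Near) (Skip 73 Deficient)))))))))) (Exp 3 2 (Cut 17 (Force 3 2 13 []
    Deficient) (Cut 23 (Force 3 2 13 [] Deficient) (Next 23 Near (Next 29 Near (Next 31 Near (Skip
    37 Deficient)))))) (Cut 35 (Cut 33 Abundant (Divide 7 Deficient)) (Cut 55 (Cut 37 (Divide 37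
    Abundant) (Exp 5 4 (Force 5 4 71 [] Abundant) (Cut 47 (Cut 39 (Divide 13 Deficient) (Cut 41
    (Divide 41 Abundant) (Cut 45 (Exp 3 4 (Force 3 4 11 [] Deficient) Abundant) (Divide 47
    Abundant)))) (Cut 49 (Divide 7 Deficient) (Cut 51 (Divide 17 Deficient) (Cut 53 (Divide 53
    Abundant) (Divide 11 Deficient))))))) (Cut 73 (Cut 65 (Cut 57 (Exp 3 4 (Force 3 4 11 []
    Deficient) (Exp 5 4 (Force 5 4 11 [] Deficient) (Exp 19 2 (Force 19 2 127 [] Abundant) (Exp 3
    6 (From 469 (Skip 473 Deficient)) (From 580 (Next 587 Index (Next 593 Index (Next 599 Index
    (Next 601 Index (Skip 603 Deficient)))))))))) (Cut 59 (Divide 59 Abundant) (Cut 61 (Divide 61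
    Abundant) (Cut 63 (Divide 7 Deficient) (Divide 13 Deficient))))) (Cut 71 (Cut 67 (Divide 67
    Abundant) (Cut 69 (Divide 23 Abundant) (Divide 71 Abundant))) (Divide 73 Abundant))) (Exp 3 4
    (From 66 (Next 67 (Exp 19 2 (Exp 5 4 Near Abundant) Abundant) (Next 71 (Exp 19 2 (Exp 71 2
    (Exp 5 4 Exact Near) Near) Near) (Next 73 Near (Next 79 Near (Next 83 Near (Next 89 Near (Next
    97 Near (Next 101 Near (Next 103 Near (Next 107 Near (Next 109 Near (Next 113 Near (Skip 127
    Deficient)))))))))))))) (From 88 (Next 89 (Exp 19 2 (Exp 5 4 (Exp 3 6 Near Abundant) Abundant)
    Abundant) (Next 97 Near (Next 101 Near (Next 103 Near (Next 107 Near (Next 109 Near (Next 113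
    Near (Next 127 Near (Next 131 Near (Next 137 Near (Next 139 Near (Next 149 Near (Next 151 Near
    (Next 157 Near (Next 163 Near (Next 167 Near (Next 173 Near (Next 179 Near (Next 181 Near
    (Next 191 Near (Next 193 Near (Next 197 Near (Next 199 Near (Next 211 Near (Next 223 Near
    (Next 227 Near (Next 229 Near (Next 233 Near (Next 239 Near (Next 241 Near (Next 251 Near
    (Next 257 Near (Next 263 Near (Skip 265 Deficient))))))))))))))))))))))))))))))))))))))))"

lemma check_3_5_19: "check cert_3_5_19 [(19, 2, False), (5, 2, False), (3, 2, False)] 21 15 0"
  by code_simp

definition cert_3_5_23 :: cert where
  "cert_3_5_23 =
    Cut 39 (Exp 3 2 (Force 3 2 13 [(33, Deficient)] Deficient) (Cut 27 (Exp 5 2 (Force 5 2 31 []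
    Abundant) (Exp 23 2 (Force 23 2 79 [] Abundant) (Exp 3 4 (Force 3 4 11 [(17, Abundant)]
    Deficient) (Exp 5 4 (Force 5 4 11 [(17, Abundant)] Deficient) (Cut 25 (Exp 3 6 (Force 3 6 1093
    [] Abundant) Abundant) (Exp 3 6 (From 536 (Skip 541 Deficient)) (From 686 (Next 691 Index
    (Next 701 Index (Next 709 Index (Skip 719 Deficient))))))))))) (Cut 35 (Cut 33 (Cut 31 (Cut 29
    (Divide 29 Abundant) (Divide 31 Abundant)) (Divide 11 Deficient)) (Divide 7 Deficient)) (Cut
    37 (Divide 37 Abundant) (Divide 13 Deficient))))) (Exp 3 2 Deficient (Exp 5 2 (From 31 (Next
    31 Abundant (Next 37 Near (Next 41 Near (Next 43 Near (Next 47 Near (Next 53 Near (Next 59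
    (Exp 3 4 Deficient Near) (Next 61 Near (Skip 65 Deficient)))))))))) (From 41 (Next 41 Abundant
    (Next 43 (Exp 3 4 Near Abundant) (Next 47 (Exp 3 4 Near Abundant) (Next 53 Near (Next 59 Near
    (Next 61 Near (Next 67 Near (Next 71 Near (Next 73 Near (Next 79 Near (Next 83 Near (Next 89
    Near (Next 97 Near (Next 101 Near (Next 103 Near (Next 107 Near (Next 109 Near (Next 113 Near
    (Next 127 Near (Skip 129 Deficient)))))))))))))))))))))))"

lemma check_3_5_23: "check cert_3_5_23 [(23, 2, False), (5, 2, False), (3, 2, False)] 25 15 0"
  by code_simp

definition cert_3_5_rest :: cert where
  "cert_3_5_rest =
    Next 29 (Exp 3 2 Deficient (Cut 21 (Cut 15 (Exp 3 4 (Force 3 4 11 [] Deficient) (Exp 5 2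
    (Force 5 2 31 [] Abundant) Abundant)) (Cut 19 (Cut 17 (Divide 17 Deficient) (Divide 19
    Deficient)) (Divide 7 Deficient))) (Next 31 (Exp 5 2 Near (Exp 3 4 Near Abundant)) (Next 37
    Near (Next 41 Near (Next 43 Near (Next 47 Near (Next 53 Near (Next 59 Near (Next 61 Near (Next
    67 Near (Next 71 Near (Next 73 Near (Next 79 Near (Next 83 Near (Next 89 Near (Next 97 Near
    (Next 101 Near (Next 103 Near (Next 107 Near (Next 109 Near (Next 113 Near (Next 127 Near
    (Next 131 Near (Skip 135 Deficient))))))))))))))))))))))))) (Next 31 (Exp 3 2 Deficient (Cut
    65 (Exp 31 2 (Force 31 2 331 [] Index) (Cut 15 (Exp 3 4 (Force 3 4 11 [] Deficient) (Exp 5 2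
    (From 158 (Next 163 Index (Next 167 Index (Skip 171 Deficient)))) Abundant)) (Cut 17 (Divide
    17 Deficient) (Cut 19 (Divide 19 Deficient) (Cut 21 (Divide 7 Deficient) (Cut 23 (Divide 23
    Deficient) (Next 37 Index (Next 41 Index (Next 43 Index (Next 47 Index (Next 53 Index (Next 59
    Index (Next 61 Index (Next 67 Index (Next 71 Index (Next 73 Index (Next 79 Index (Next 83
    Index (Skip 89 Deficient))))))))))))))))))) (Next 37 Near (Next 41 Near (Skip 43
    Deficient))))) (Next 37 (Exp 3 2 Deficient (Cut 21 (Cut 19 (Cut 17 (Exp 5 2 (Force 5 2 31 []
    Deficient) (Cut 15 (Exp 3 4 (Force 3 4 11 [] Deficient) (Exp 5 4 (Force 5 4 11 [] Deficient)
    (Exp 3 6 (Force 3 6 1093 [] Deficient) (From 301 (Next 307 Index (Skip 311 Deficient))))))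
    (Divide 17 Deficient))) (Divide 19 Deficient)) (Divide 7 Deficient)) (Next 41 Near (Next 43
    Near (Next 47 Near (Next 53 Near (Next 59 Near (Next 61 Near (Skip 67 Deficient))))))))) (Next
    41 (Exp 3 2 Deficient (Cut 21 (Cut 19 (Cut 17 (Exp 5 2 (Force 5 2 31 [] Deficient) (Cut 15
    (Exp 3 4 (Force 3 4 11 [] Deficient) (From 148 (Next 149 Index (Next 151 Index (Next 157 Index
    (Next 163 Index (Next 167 Index (Skip 169 Deficient)))))))) (Divide 17 Deficient))) (Divide 19
    Deficient)) (Divide 7 Deficient)) (Next 43 Near (Next 47 Near (Next 53 Near (Skip 57
    Deficient)))))) (Next 43 (Exp 3 2 Deficient (Cut 19 (Cut 17 (Cut 15 (Exp 5 2 (Force 5 2 31 []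
    Deficient) (Exp 3 4 (Force 3 4 11 [] Deficient) (From 127 (Next 127 Abundant (Next 131 Index
    (Next 137 Index (Next 139 Index (Skip 143 Deficient)))))))) (Divide 17 Deficient)) (Divide 19
    Deficient)) (Next 47 Near (Next 53 Near (Next 59 Near (Skip 61 Deficient)))))) (Next 47 (Cut
    25 (Exp 3 2 Deficient (Exp 5 2 (Force 5 2 31 [] Deficient) (Cut 15 (Exp 3 4 (Force 3 4 11 []
    Deficient) (From 101 (Next 101 Abundant (Next 103 Index (Next 107 Index (Next 109 Index (Skip
    111 Deficient))))))) (Cut 17 (Divide 17 Deficient) (Next 53 Index (Next 59 Index (Next 61
    Index (Skip 63 Deficient)))))))) Deficient) (Next 53 (Next 59 (Exp 5 2 Deficient Near) (Next
    61 Near (Next 67 Near (Next 71 Near (Next 73 Near (Next 79 Near (Next 83 Near (Skip 87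
    Deficient)))))))) (Next 59 (Next 61 Near (Next 67 Near (Next 71 (Exp 3 2 Deficient (Exp 5 2
    Deficient (Exp 3 4 Deficient Near))) (Next 73 Near (Skip 75 Deficient))))) (Next 61 (Next 67
    Near (Next 71 Near (Skip 73 Deficient))) (Skip 67 Deficient)))))))))"

lemma check_3_5_rest: "check cert_3_5_rest [(5, 2, False), (3, 2, False)] 24 15 0"
  by code_simp

definition cert_3_7 :: cert where
  "cert_3_7 =
    Next 11 (Cut 55 (Exp 3 2 (Force 3 2 13 [(33, From 16 (Next 17 Deficient (Skip 19 Deficient)))]
    Abundant) (Cut 11 Abundant (Exp 11 2 (Force 11 2 19 [(29, Divide 29 Abundant)] Abundant) (Cut
    13 (Divide 13 Abundant) (Cut 15 (Divide 5 Deficient) (Cut 17 (Divide 17 Abundant) (Cut 19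
    (Divide 19 Abundant) (From 28 (Next 29 Index (Next 31 Index (Next 37 Index (Next 41 Index
    (Next 43 Index (Next 47 (Exp 7 2 Near Index) (Next 53 Index (Next 59 Near (Next 61 Index (Next
    67 Index (Next 71 Index (Skip 73 Deficient)))))))))))))))))))) (Exp 3 2 (Next 13 (Exp 7 2 (Exp
    11 2 (Exp 13 2 Exact Abundant) Abundant) Abundant) (Skip 17 Deficient)) (Exp 7 2 (Exp 3 4
    (From 22 (Next 23 (Exp 11 2 (Exp 23 2 Exact Near) Near) (Skip 29 Deficient))) (From 24 (Next
    29 Near (Next 31 Near (Skip 33 Deficient))))) (From 23 (Next 23 Abundant (Next 29 Near (Next
    31 Near (Skip 35 Deficient)))))))) (Next 13 (Cut 39 (Exp 3 2 (Next 17 Index (Next 19 Index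
    (Skip 23 Deficient))) (Cut 11 (Divide 11 Deficient) (From 21 (Next 23 Index (Next 29 Index
    (Next 31 Index (Next 37 Index (Next 41 Index (Next 43 Index (Next 47 Index (Next 53 Index
    (Next 59 Index (Next 61 Index (Next 67 Index (Skip 71 Deficient))))))))))))))) (Exp 3 2
    Deficient (Exp 3 4 (From 16 (Next 17 (Exp 7 2 (Exp 13 2 Near (Exp 17 2 Near Abundant))
    Abundant) (Next 19 Near (Skip 23 Deficient)))) (From 17 (Next 17 Abundant (Next 19 (Exp 7 2
    Near (Exp 13 2 (Exp 19 2 Near (Exp 3 6 Near Abundant)) (Exp 19 2 (Exp 3 6 Near Abundant)
    Abundant))) (Next 23 Near (Skip 25 Deficient)))))))) (Next 17 (Next 19 Near (Next 23 Near
    (Next 29 Near (Next 31 Near (Next 37 Near (Skip 39 Deficient)))))) (Next 19 (Next 23 Near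
    (Next 29 Near (Skip 31 Deficient))) (Next 23 Deficient (Skip 29 Deficient)))))"

lemma check_3_7: "check cert_3_7 [(7, 2, False), (3, 2, False)] 9 11 0"
  by code_simp

definition certificate :: cert where
  "certificate =
    Next 3 (Cut 3 cert_index_3 (Cut 5 (Divide 5 cert_index_5) (Cut 7 (Divide 7 cert_index_7) (Cut
    9 cert_index_9 (Next 5 (Cut 11 (Divide 11 Abundant) (Cut 13 (Divide 13 Abundant) (Next 7
    Abundant (Next 11 cert_3_5_11 (Next 13 cert_3_5_13 (Next 17 cert_3_5_17 (Next 19 cert_3_5_19
    (Next 23 cert_3_5_23 cert_3_5_rest)))))))) (Next 7 cert_3_7 (Next 11 (Next 13 (Skip 17
    Deficient) (Skip 15 Deficient)) (Next 13 Deficient (Skip 17 Deficient))))))))) (Skip 5 (Cut 3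
    (Divide 3 Deficient) (Next 5 (Next 7 (Skip 11 Deficient) (Skip 9 Deficient)) (Next 7 Deficient
    (Skip 9 Deficient)))))"

lemma check_certificate: "check certificate [] 3 3 0"
  unfolding certificate_def
  by (simp add: gap_def primes_def upt_rec check_index_3 check_index_5 check_index_7 check_index_9 check_3_5_11 check_3_5_13 check_3_5_17 check_3_5_19 check_3_5_23 check_3_5_rest check_3_7)

section \<open>The unique solution\<close>

lemma sigma_target: "sigma (3^2 * 7^2 * 11^2 * 13^2) + 819 = 2 * (3^2 * 7^2 * 11^2 * 13^2)"
proof -
  have pr: "prime (3::nat)" "prime (7::nat)" "prime (11::nat)" "prime (13::nat)" by simp_all
  have "sigma (\<Prod>p\<in>{3, 7, 11, 13}. p ^ 2) = (\<Prod>p\<in>{3, 7, 11, 13}. geo p 2)"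
    by (rule sigma_prod_prime_powers) (use pr in blast)+
  moreover have "geo p 2 = 1 + p + p * p" for p
    by (simp add: geo_def numeral_2_eq_2)
  moreover have "(\<Prod>p\<in>{3, 7, 11, 13}. f p) = f 3 * f 7 * f 11 * f 13" for f :: "nat \<Rightarrow> nat"
    by simp
  ultimately have "sigma (3^2 * 7^2 * 11^2 * 13^2) = 13 * 57 * 133 * 183" by simp
  then show ?thesis by simp
qed

theorem theorem1p1:
  fixes n :: nat
  assumes "n > 0" and "odd n" and "card (prime_factors n) = 4"
  shows "deficient_perfect n \<longleftrightarrow> n = 3^2 * 7^2 * 11^2 * 13^2"
proof
  assume "deficient_perfect n"
  then obtain d where d: "d dvd n" "d < n" "sigma n = 2 * n - d"
    by (auto simp: deficient_perfect_def)
  then obtain k where k: "n = k * d" by (metis dvdE mult.commute)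
  have "k \<noteq> 0" "k \<noteq> 1" using k d(2) assms(1) by auto
  then interpret solution n d k
    using assms d k by unfold_locales auto
  show "n = 3^2 * 7^2 * 11^2 * 13^2"
    using check_sound[OF check_certificate box_root] by simp
next
  assume n: "n = 3^2 * 7^2 * 11^2 * 13^2"
  have "sigma n = 2 * n - 819" using sigma_target unfolding n by linarith
  moreover have "819 dvd n" "819 < n" unfolding n by simp_all
  ultimately show "deficient_perfect n" unfolding deficient_perfect_def by blast
qed

end
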